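(* Let $C$ be a linear code of length $n$ over a finite commutative Frobenius ring $R$, and let $\{a_0,a_1,\dots,a_t\}$ be a set of representatives of the classes of $\approx$ on $R$. Then $$\mathrm{swe}_{C^\perp}(\mathbf{x})=\frac{1}{|C|}\,\mathrm{swe}_C\big(\mathbf{Q}\mathbf{D}\mathbf{A}^{-1}\mathbf{x}\big),$$ where $\mathbf{Q},\mathbf{D},\mathbf{A}$ are the following $(t+1)\times(t+1)$ matrices with rows and columns indexed by $\{0,1,\dots,t\}$: $\mathbf{A}$ is the adjacency matrix of the poset of principal ideals of $R$ under set inclusion (in particular it is invertible); $\mathbf{D}$ is the diagonal matrix with diagonal entries $|a_0R|,|a_1R|,\dots,|a_tR|$ respectively; and $\mathbf{Q}=(q_{ij})$ is the symmetric matrix with $$q_{ij}:=\begin{cases}0,&\text{if } a_i\neq 0 \text{ and } a_kR\subseteq a_jR \text{ for some } k \text{ such that } a_ia_k\neq 0;\\ 1,&\text{otherwise.}\end{cases}$$ Equivalently, $$q_{ij}=\begin{cases}1,&\text{if } a_jR\subseteq (a_iR)^\perp;\\ 0,&\text{otherwise.}\end{cases}$$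
   Context: Rings have an identity. A finite commutative ring $R$ is Frobenius if $R/\mathrm{Rad}(R)\cong \mathrm{Soc}(R)$ as $R$-modules ($\mathrm{Rad}$ the Jacobson radical, $\mathrm{Soc}$ the socle). A linear code $C$ of length $n$ over $R$ is an $R$-submodule of $R^n$; its dual is $C^\perp=\{\mathbf v\in R^n: \mathbf u\cdot\mathbf v=0\text{ for all }\mathbf u\in C\}$, where $\mathbf u\cdot\mathbf v=\sum_{\ell=1}^n u_\ell v_\ell$. For $c\in R$, $cR=\{cb:b\in R\}$, and $(cR)^\perp=\{r\in R: cr=0\}$ (dual of the length-1 code $cR$). Write $r\approx s$ if $r=us$ for some unit $u$ of $R$ (equivalently $rR=sR$). Let $t$ be the number of nonzero principal ideals of $R$, so there are $t+1$ classes of $\approx$; $\{a_0,\dots,a_t\}$ is a fixed indexed set of representatives, so the $a_iR$ are pairwise distinct and are all the principal ideals of $R$. For $\mathbf c=(c_1,\dots,c_n)\in R^n$ let $S_i(\mathbf c)=\{\ell\in\{1,\dots,n\}: c_\ell R=a_iR\}$ for $0\le i\le t$. With $\mathbf x=(x_0,\dots,x_t)^{T}$ a column vector of indeterminates, the symmetrized weight enumerator of $C$ is $\mathrm{swe}_C(\mathbf x)=\sum_{\mathbf c\in C}\prod_{i=0}^t x_i^{|S_i(\mathbf c)|}$; for a matrix $\mathbf M$, $\mathrm{swe}_C(\mathbf M\mathbf x)$ means substituting the $i$-th entry of $\mathbf M\mathbf x$ for $x_i$. The adjacency matrix of the poset of principal ideals of $R$ under set inclusion is the $(t+1)\times(t+1)$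 matrix whose $(i,j)$ entry is $1$ if $a_iR\subseteq a_jR$ (including $i=j$) and $0$ otherwise. *)

theory Defs
  imports
    "HOL-Algebra.Algebra"
    "HOL-Library.FuncSet"
    "HOL-Library.Poly_Mapping"
    "Jordan_Normal_Form.Gauss_Jordan_Elimination"
begin

section \<open>Finite Frobenius rings\<close>

definition module_isomorphic ::
  "('a, 'r) ring_scheme \<Rightarrow> ('a, 'b, 'm) module_scheme \<Rightarrow> ('a, 'c, 'n) module_scheme \<Rightarrow> bool" where
  "module_isomorphic R M N \<longleftrightarrow>
     (\<exists>h. bij_betw h (carrier M) (carrier N) \<and>
        (\<forall>x\<in>carrier M. \<forall>y\<in>carrier M. h (x \<oplus>\<^bsub>M\<^esub> y) = h x \<oplus>\<^bsub>N\<^esub> h y) \<and>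
        (\<forall>r\<in>carrier R. \<forall>x\<in>carrier M. h (r \<odot>\<^bsub>M\<^esub> x) = r \<odot>\<^bsub>N\<^esub> h x))"

text \<open>The intersection with the carrier only matters for the zero ring, which has no
  maximal ideals and whose radical is the whole ring.\<close>

definition jacobson_radical :: "('a, 'r) ring_scheme \<Rightarrow> 'a set" where
  "jacobson_radical R = carrier R \<inter> \<Inter>{M. maximalideal M R}"

definition minimal_ideal :: "'a set \<Rightarrow> ('a, 'r) ring_scheme \<Rightarrow> bool" where
  "minimal_ideal I R \<longleftrightarrow> ideal I R \<and> I \<noteq> {\<zero>\<^bsub>R\<^esub>} \<and>
     (\<forall>J. ideal J R \<longrightarrow> J \<subseteq> I \<longrightarrow> J = {\<zero>\<^bsub>R\<^esub>} \<or> J = I)"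

text \<open>The ideal generated by the union of the minimal ideals is their sum; over a commutative
  ring the minimal ideals are exactly the simple submodules of the regular module.\<close>

definition socle :: "('a, 'r) ring_scheme \<Rightarrow> 'a set" where
  "socle R = Idl\<^bsub>R\<^esub> (\<Union>{I. minimal_ideal I R})"

definition regular_module :: "('a, 'r) ring_scheme \<Rightarrow> ('a, 'a) module" where
  "regular_module R =
     \<lparr>carrier = carrier R, monoid.mult = monoid.mult R, one = one R,
      ring.zero = ring.zero R, add = add R, smult = monoid.mult R\<rparr>"

text \<open>The ring \<open>R Quot I\<close>, on which \<open>R\<close> acts through the projection \<open>R \<rightarrow> R Quot I\<close>.\<close>

definition quotient_module :: "('a, 'r) ring_scheme \<Rightarrow> 'a set \<Rightarrow> ('a, 'a set) module" where
  "quotient_module R I =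
     \<lparr>carrier = carrier (R Quot I), monoid.mult = monoid.mult (R Quot I), one = one (R Quot I),
      ring.zero = ring.zero (R Quot I), add = add (R Quot I),
      smult = (\<lambda>r Y. (I +>\<^bsub>R\<^esub> r) \<otimes>\<^bsub>R Quot I\<^esub> Y)\<rparr>"

definition frobenius_ring :: "('a, 'r) ring_scheme \<Rightarrow> bool" where
  "frobenius_ring R \<longleftrightarrow>
     module_isomorphic R (quotient_module R (jacobson_radical R))
       ((regular_module R)\<lparr>carrier := socle R\<rparr>)"

lemma regular_module_is_module:
  assumes "cring R" shows "module R (regular_module R)"
proof -
  interpret cring R by fact
  show ?thesis
    by (intro moduleI abelian_groupI; (fact assms)?)
     (auto simp: regular_module_def a_ac m_ac l_distr r_distr intro: l_neg)
qed

lemma quotient_module_is_module: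
  assumes "cring R" "ideal I R" shows "module R (quotient_module R I)"
proof -
  interpret cring R by fact
  interpret I: ideal I R by fact
  interpret Q: ring "R Quot I" by (rule I.quotient_is_ring)
  note h = ring_hom_closed[OF I.rcos_ring_hom] ring_hom_mult[OF I.rcos_ring_hom]
    ring_hom_add[OF I.rcos_ring_hom] ring_hom_one[OF I.rcos_ring_hom]
  note sel = quotient_module_def module.simps ring.simps monoid.simps partial_object.simps
  have "abelian_group (quotient_module R I)"
    by (intro abelian_groupI; unfold sel)
       (assumption | rule Q.add.m_closed Q.zero_closed Q.a_assoc Q.a_comm Q.l_zero
          bexI[where P = "\<lambda>y. y \<oplus>\<^bsub>R Quot I\<^esub> x = \<zero>\<^bsub>R Quot I\<^esub>" for x] Q.l_neg Q.a_inv_closed)+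
  then show ?thesis
    by (intro moduleI assms; unfold sel)
       (simp_all only: h Q.m_closed Q.l_distr Q.r_distr Q.m_assoc Q.l_one)
qed

lemma socle_ideal:
  assumes "cring R" shows "ideal (socle R) R"
proof -
  interpret cring R by fact
  show ?thesis unfolding socle_def minimal_ideal_def
    by (intro genideal_ideal) (auto dest: ideal.Icarr)
qed

lemma jacobson_radical_ideal:
  assumes "cring R" shows "ideal (jacobson_radical R) R"
proof -
  interpret cring R by fact
  have "jacobson_radical R = \<Inter>(insert (carrier R) {M. maximalideal M R})"
    unfolding jacobson_radical_def by simp
  also have "ideal \<dots> R"
    by (intro i_Intersect) (auto intro: oneideal maximalideal.axioms(1))
  finally show ?thesis .
qed

section \<open>Linear codes\<close>

text \<open>Vectors are extensional functions on \<open>{1..n}\<close>. The product and the unit of the record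
  play no role in its module structure.\<close>

definition free_module :: "('a, 'r) ring_scheme \<Rightarrow> nat \<Rightarrow> ('a, nat \<Rightarrow> 'a) module" where
  "free_module R n =
     \<lparr>carrier = {1..n} \<rightarrow>\<^sub>E carrier R,
      monoid.mult = (\<lambda>u v. \<lambda>l\<in>{1..n}. u l \<otimes>\<^bsub>R\<^esub> v l),
      one = (\<lambda>l\<in>{1..n}. \<one>\<^bsub>R\<^esub>),
      ring.zero = (\<lambda>l\<in>{1..n}. \<zero>\<^bsub>R\<^esub>),
      add = (\<lambda>u v. \<lambda>l\<in>{1..n}. u l \<oplus>\<^bsub>R\<^esub> v l),
      smult = (\<lambda>r v. \<lambda>l\<in>{1..n}. r \<otimes>\<^bsub>R\<^esub> v l)\<rparr>"

lemma free_module_is_module: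
  assumes "cring R" shows "module R (free_module R n)"
proof -
  interpret cring R by fact
  have inv: "\<exists>y\<in>carrier (free_module R n). y \<oplus>\<^bsub>free_module R n\<^esub> x = \<zero>\<^bsub>free_module R n\<^esub>"
    if "x \<in> carrier (free_module R n)" for x
  proof (rule bexI)
    have x: "x l \<in> carrier R" if "l \<in> {1..n}" for l
      using \<open>x \<in> carrier (free_module R n)\<close> that by (auto simp: free_module_def)
    show "(\<lambda>l\<in>{1..n}. \<ominus>\<^bsub>R\<^esub> (x l)) \<in> carrier (free_module R n)"
      using x by (simp add: free_module_def)
    show "(\<lambda>l\<in>{1..n}. \<ominus>\<^bsub>R\<^esub> (x l)) \<oplus>\<^bsub>free_module R n\<^esub> x = \<zero>\<^bsub>free_module R n\<^esub>"
      using x by (auto simp: free_module_def l_neg restrict_def)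
  qed
  show ?thesis
    by (intro moduleI abelian_groupI; (fact assms | fact inv)?)
     (auto simp: free_module_def PiE_iff fun_eq_iff extensional_def restrict_def
        a_ac m_ac l_distr r_distr)
qed

definition linear_code :: "('a, 'r) ring_scheme \<Rightarrow> nat \<Rightarrow> (nat \<Rightarrow> 'a) set \<Rightarrow> bool" where
  "linear_code R n C \<longleftrightarrow> submodule C R (free_module R n)"

definition dot :: "('a, 'r) ring_scheme \<Rightarrow> nat \<Rightarrow> (nat \<Rightarrow> 'a) \<Rightarrow> (nat \<Rightarrow> 'a) \<Rightarrow> 'a" where
  "dot R n u v = (\<Oplus>\<^bsub>R\<^esub>l\<in>{1..n}. u l \<otimes>\<^bsub>R\<^esub> v l)"

definition dual_code :: "('a, 'r) ring_scheme \<Rightarrow> nat \<Rightarrow> (nat \<Rightarrow> 'a) set \<Rightarrow> (nat \<Rightarrow> 'a) set" where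
  "dual_code R n C = {v \<in> carrier (free_module R n). \<forall>u\<in>C. dot R n u v = \<zero>\<^bsub>R\<^esub>}"

text \<open>The dual of the code \<open>cR\<close> of length 1, as a subset of \<open>R\<close>.\<close>

definition principal_dual :: "('a, 'r) ring_scheme \<Rightarrow> 'a \<Rightarrow> 'a set" where
  "principal_dual R c = {r \<in> carrier R. c \<otimes>\<^bsub>R\<^esub> r = \<zero>\<^bsub>R\<^esub>}"

definition unit_equiv :: "('a, 'r) ring_scheme \<Rightarrow> 'a \<Rightarrow> 'a \<Rightarrow> bool" where
  "unit_equiv R r s \<longleftrightarrow> (\<exists>u\<in>Units R. r = u \<otimes>\<^bsub>R\<^esub> s)"

text \<open>For given \<open>R\<close> this determines \<open>t\<close>: the number of classes is \<open>t + 1\<close>.\<close>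

definition representatives :: "('a, 'r) ring_scheme \<Rightarrow> nat \<Rightarrow> (nat \<Rightarrow> 'a) \<Rightarrow> bool" where
  "representatives R t a \<longleftrightarrow>
     (\<forall>i\<le>t. a i \<in> carrier R) \<and>
     (\<forall>r\<in>carrier R. \<exists>!i. i \<le> t \<and> unit_equiv R r (a i))"

section \<open>Polynomials in the indeterminates $x_0, x_1, \dots$\<close>

text \<open>An exponent vector is a finitely supported function on the indices of the
  indeterminates; a polynomial is a finitely supported function on exponent vectors, with the
  convolution product.\<close>

type_synonym 'k mpoly = "(nat \<Rightarrow>\<^sub>0 nat) \<Rightarrow>\<^sub>0 'k"

definition Const :: "'k::comm_ring_1 \<Rightarrow> 'k mpoly" where
  "Const c = Poly_Mapping.single 0 c"

definition Var :: "nat \<Rightarrow> 'k::comm_ring_1 mpoly" where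
  "Var i = Poly_Mapping.single (Poly_Mapping.single i 1) 1"

definition mpoly_subst :: "(nat \<Rightarrow> 'k::comm_ring_1 mpoly) \<Rightarrow> 'k mpoly \<Rightarrow> 'k mpoly" where
  "mpoly_subst s p =
     (\<Sum>m\<in>Poly_Mapping.keys p. Const (Poly_Mapping.lookup p m) *
        (\<Prod>i\<in>Poly_Mapping.keys m. s i ^ Poly_Mapping.lookup m i))"

section \<open>The symmetrized weight enumerator and the matrices\<close>

definition positions ::
  "('a, 'r) ring_scheme \<Rightarrow> nat \<Rightarrow> (nat \<Rightarrow> 'a) \<Rightarrow> nat \<Rightarrow> (nat \<Rightarrow> 'a) \<Rightarrow> nat set" where
  "positions R n a i c = {l \<in> {1..n}. PIdl\<^bsub>R\<^esub> (c l) = PIdl\<^bsub>R\<^esub> (a i)}"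

definition swe ::
  "('a, 'r) ring_scheme \<Rightarrow> nat \<Rightarrow> nat \<Rightarrow> (nat \<Rightarrow> 'a) \<Rightarrow> (nat \<Rightarrow> 'a) set \<Rightarrow> 'k::comm_ring_1 mpoly" where
  "swe R n t a C = (\<Sum>c\<in>C. \<Prod>i\<le>t. Var i ^ card (positions R n a i c))"

definition indeterminates :: "nat \<Rightarrow> 'k::comm_ring_1 mpoly vec" where
  "indeterminates t = vec (t + 1) Var"

definition mat_subst :: "nat \<Rightarrow> 'k::comm_ring_1 mat \<Rightarrow> 'k mpoly \<Rightarrow> 'k mpoly" where
  "mat_subst t M p = mpoly_subst (\<lambda>i. (map_mat Const M *\<^sub>v indeterminates t) $ i) p"

definition adj_mat :: "('a, 'r) ring_scheme \<Rightarrow> nat \<Rightarrow> (nat \<Rightarrow> 'a) \<Rightarrow> 'k::comm_ring_1 mat" where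
  "adj_mat R t a =
     mat (t + 1) (t + 1) (\<lambda>(i, j). if PIdl\<^bsub>R\<^esub> (a i) \<subseteq> PIdl\<^bsub>R\<^esub> (a j) then 1 else 0)"

definition size_mat :: "('a, 'r) ring_scheme \<Rightarrow> nat \<Rightarrow> (nat \<Rightarrow> 'a) \<Rightarrow> 'k::comm_ring_1 mat" where
  "size_mat R t a = mat_diag (t + 1) (\<lambda>i. of_nat (card (PIdl\<^bsub>R\<^esub> (a i))))"

definition q_mat :: "('a, 'r) ring_scheme \<Rightarrow> nat \<Rightarrow> (nat \<Rightarrow> 'a) \<Rightarrow> 'k::comm_ring_1 mat" where
  "q_mat R t a =
     mat (t + 1) (t + 1) (\<lambda>(i, j).
       if a i \<noteq> \<zero>\<^bsub>R\<^esub> \<and>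
          (\<exists>k\<le>t. PIdl\<^bsub>R\<^esub> (a k) \<subseteq> PIdl\<^bsub>R\<^esub> (a j) \<and> a i \<otimes>\<^bsub>R\<^esub> a k \<noteq> \<zero>\<^bsub>R\<^esub>)
       then 0 else 1)"

definition q_mat' :: "('a, 'r) ring_scheme \<Rightarrow> nat \<Rightarrow> (nat \<Rightarrow> 'a) \<Rightarrow> 'k::comm_ring_1 mat" where
  "q_mat' R t a =
     mat (t + 1) (t + 1) (\<lambda>(i, j).
       if PIdl\<^bsub>R\<^esub> (a j) \<subseteq> principal_dual R (a i) then 1 else 0)"

text \<open>Unspecified when \<open>A\<close> is not invertible.\<close>

definition inv_mat :: "'k::field mat \<Rightarrow> 'k mat" where
  "inv_mat A = the (mat_inverse A)"

lemma inv_mat_inverse: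
  assumes "invertible_mat A" "A \<in> carrier_mat m m"
  shows "inv_mat A \<in> carrier_mat m m" "A * inv_mat A = 1\<^sub>m m" "inv_mat A * A = 1\<^sub>m m"
proof -
  obtain B where B: "A * B = 1\<^sub>m m" "B * A = 1\<^sub>m (dim_row B)"
    using assms by (auto simp: invertible_mat_def inverts_mat_def)
  have "B \<in> carrier_mat m m" using B assms(2)
    by (metis carrier_matD(1,2) carrier_matI index_mult_mat(2,3) index_one_mat(2,3))
  with B assms(2) have "A \<in> Units (ring_mat TYPE('a) m ())"
    by (auto simp: Units_def ring_mat_def)
  then obtain C where "mat_inverse A = Some C" using mat_inverse(1)[OF assms(2), where b="()"]
    by (cases "mat_inverse A") auto
  with mat_inverse(2)[OF assms(2) this]
  show "inv_mat A \<in> carrier_mat m m" "A * inv_mat A = 1\<^sub>m m" "inv_mat A * A = 1\<^sub>m m"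
    by (auto simp: inv_mat_def)
qed

end

theory Submission
  imports "Jordan_Normal_Form.Determinant" Defs
begin

text \<open>Write \<open>y = A\<^sup>-\<^sup>1 x\<close>, so that \<open>x\<^sub>i = (A y)\<^sub>i\<close>. Expanding both enumerators in the monomials
  \<open>y\<^bsub>J 1\<^esub> \<cdots> y\<^bsub>J n\<^esub>\<close> turns the identity into \<open>|C| |D \<inter> C\<^sup>\<bottom>| = |D| |C \<inter> D\<^sup>\<bottom>|\<close> for the codes
  \<open>D = a\<^bsub>J 1\<^esub>R \<times> \<cdots> \<times> a\<^bsub>J n\<^esub>R\<close>. This holds for all submodules \<open>C\<close>, \<open>D\<close> of \<open>R\<^sup>n\<close>, with no need of a
  generating character: by symmetry \<open>\<le>\<close> suffices, and it follows along a chain of submodules of \<open>D\<close>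
  with simple quotients, because over a Frobenius ring \<open>|ann m| \<le> |R/m|\<close> for every maximal ideal
  \<open>m\<close>. The last bound holds since \<open>ann m\<close> lies in the socle, which is isomorphic to \<open>R/Rad R\<close>, and an
  element of \<open>m\<close> that \<open>m\<close> multiplies into \<open>Rad R\<close> lies in \<open>Rad R\<close>.\<close>

section \<open>Finite commutative rings\<close>

text \<open>By the pigeonhole principle the powers of \<open>x\<close> are eventually periodic; an
  exponent in the periodic range that is a multiple of the period gives an idempotent.\<close>

lemma (in monoid) finite_idempotent_power:
  assumes "finite (carrier G)" and x: "x \<in> carrier G"
  obtains N :: nat where "N > 0" and "x [^] N \<otimes> x [^] N = x [^] N"
proof -
  have "range (\<lambda>n::nat. x [^] n) \<subseteq> carrier G" using x by auto
  with assms(1) have "finite (range (\<lambda>n::nat. x [^] n))" by (rule rev_finite_subset)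
  then have "\<not> inj (\<lambda>n::nat. x [^] n)" by (auto dest: finite_imageD)
  then obtain i j :: nat where "x [^] i = x [^] j" "i < j"
    by (meson linorder_injI)
  then obtain p where p: "p > 0" and eq: "x [^] i = x [^] (i + p)"
    using less_imp_add_positive by blast
  have step: "x [^] (k + m * p) = x [^] k" if ki: "k \<ge> i" for k m
  proof (induction m)
    case (Suc m)
    obtain l where l: "k = i + l" using le_Suc_ex[OF ki] by auto
    have "x [^] (k + Suc m * p) = x [^] ((i + p) + (l + m * p))" unfolding l by (simp add: add_ac)
    also have "\<dots> = x [^] i \<otimes> x [^] (l + m * p)"
      unfolding eq by (rule nat_pow_mult[OF x, symmetric])
    also have "\<dots> = x [^] (k + m * p)" unfolding l add.assoc by (rule nat_pow_mult[OF x])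
    finally show ?case using Suc by simp
  qed simp
  \<comment> \<open>This exponent lies in the periodic range and is a multiple of the period
    \<open>p\<close>, so doubling it does not change the power. The \<open>Suc\<close> keeps it
    positive when \<open>i\<close> is 0.\<close>
  have "Suc i * p \<ge> i" using p by (cases p) auto
  from step[OF this, of "Suc i"] have "x [^] (Suc i * p) \<otimes> x [^] (Suc i * p) = x [^] (Suc i * p)"
    using x by (simp add: nat_pow_mult)
  moreover have "Suc i * p > 0" using p by simp
  ultimately show ?thesis using that by blast
qed

lemma (in cring) PIdl_subset_iff:
  assumes "r \<in> carrier R" "s \<in> carrier R"
  shows "PIdl r \<subseteq> PIdl s \<longleftrightarrow> r \<in> PIdl s"
  using assms cgenideal_self cgenideal_minimal cgenideal_ideal by blast

text \<open>Two generators of one ideal satisfy \<open>r = x s\<close> and \<open>s = y r\<close>,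
  but \<open>x\<close> need not be a unit. If \<open>e\<close> is an idempotent power of
  \<open>x\<close>, then \<open>x\<close> is invertible on the factor \<open>eR\<close>, which
  contains \<open>s\<close>; on the complementary factor it can be replaced by 1 without changing
  the product with \<open>s\<close>. This links the classes in \<open>representatives\<close> to the
  ideals in \<open>positions\<close>.\<close>

lemma (in cring) unit_equiv_iff_PIdl_eq:
  assumes fin: "finite (carrier R)" and r: "r \<in> carrier R" and s: "s \<in> carrier R"
  shows "unit_equiv R r s \<longleftrightarrow> PIdl r = PIdl s"
proof
  assume "unit_equiv R r s"
  then obtain u where u: "u \<in> Units R" "r = u \<otimes> s" by (auto simp: unit_equiv_def)
  then have "s = inv u \<otimes> r" using s Units_closed[OF u(1)] by (simp add: m_assoc[symmetric])
  then show "PIdl r = PIdl s"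
    using u r s PIdl_subset_iff[OF r s] PIdl_subset_iff[OF s r] by (auto simp: cgenideal_def)
next
  assume eq: "PIdl r = PIdl s"
  obtain x where x: "x \<in> carrier R" "r = x \<otimes> s"
    using cgenideal_self[OF r] unfolding eq by (auto simp: cgenideal_def)
  obtain y where y: "y \<in> carrier R" "s = y \<otimes> r"
    using cgenideal_self[OF s] unfolding eq[symmetric] by (auto simp: cgenideal_def)
  obtain N :: nat where N: "N > 0" "x [^] N \<otimes> x [^] N = x [^] N"
    using finite_idempotent_power[OF fin x(1)] .
  define e where "e = x [^] N"
  define f where "f = \<one> \<ominus> e"
  define u where "u = x \<otimes> e \<oplus> f"
  \<comment> \<open>Since \<open>N\<close> is positive, \<open>x z = e\<close>: \<open>z\<close>
    inverts \<open>x\<close> on \<open>eR\<close>, and \<open>v\<close> will be the inverse of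
    \<open>u\<close>.\<close>
  define z where "z = x [^] (N - 1)"
  define v where "v = z \<otimes> e \<oplus> f"
  have e: "e \<in> carrier R" "e \<otimes> e = e" using x N by (auto simp: e_def)
  \<comment> \<open>Multiplication by \<open>x y\<close> fixes \<open>s\<close>, hence so does every
    power of it; the power \<open>N\<close> then shows that \<open>s\<close> lies in
    \<open>eR\<close>.\<close>
  have pow: "s = (x \<otimes> y) [^] k \<otimes> s" for k :: nat
  proof (induction k)
    case (Suc k)
    have "(x \<otimes> y) [^] Suc k \<otimes> s = (x \<otimes> y) [^] k \<otimes> (y \<otimes> (x \<otimes> s))"
      using x(1) y(1) s by (simp add: m_ac)
    also have "\<dots> = s" by (simp flip: x(2) y(2) Suc)
    finally show ?case by simp
  qed (use s in simp)
  have se: "s = e \<otimes> (y [^] N \<otimes> s)"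
    using pow[of N] x(1) y(1) s by (simp add: e_def nat_pow_distrib m_assoc)
  have "e \<otimes> s = (e \<otimes> e) \<otimes> (y [^] N \<otimes> s)" using se e(1) y(1) s by (metis m_assoc nat_pow_closed m_closed)
  then have es: "e \<otimes> s = s" using se e(2) by simp
  have z: "z \<in> carrier R" "x \<otimes> z = e"
    using N x(1) nat_pow_Suc2[of x "N - 1"] by (simp_all add: e_def z_def)
  have f: "f \<in> carrier R" "e \<oplus> f = \<one>" using e(1) by (simp_all add: f_def minus_eq a_comm[of \<one> "\<ominus> e"] r_neg2)
  have ef: "e \<otimes> f = \<zero>" using e by (simp add: f_def minus_eq r_distr r_minus r_neg)
  have ff: "f \<otimes> f = f" using l_distr[OF e(1) f(1) f(1)] e(1) f ef by simp
  have "u \<otimes> v = (x \<otimes> z) \<otimes> (e \<otimes> e) \<oplus> x \<otimes> (e \<otimes> f) \<oplus> z \<otimes> (e \<otimes> f) \<oplus> f \<otimes> f"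
    using x(1) e(1) z(1) f(1) unfolding u_def v_def by (simp add: l_distr r_distr a_ac m_ac)
  also have "\<dots> = e \<oplus> f" unfolding z(2) e(2) ef ff using x(1) z(1) e f(1) by simp
  also have "\<dots> = \<one>" by (rule f(2))
  finally have uv: "u \<otimes> v = \<one>" .
  have uv_carr: "u \<in> carrier R" "v \<in> carrier R" using x(1) e z f by (auto simp: u_def v_def)
  then have "u \<in> Units R" using uv m_comm[of u v] unfolding Units_def by auto
  moreover have "f \<otimes> s = f \<otimes> e \<otimes> s" using f(1) e(1) s es by (simp add: m_assoc)
  then have "f \<otimes> s = \<zero>" using ef f(1) e(1) s by (simp add: m_comm)
  then have "u \<otimes> s = x \<otimes> (e \<otimes> s)"
    using x(1) e(1) f(1) s unfolding u_def by (simp add: l_distr m_assoc)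
  then have "u \<otimes> s = r" using es x by simp
  ultimately show "unit_equiv R r s" unfolding unit_equiv_def by blast
qed

section \<open>Maximal ideals, socle and radical\<close>

text \<open>This is the inverse of \<open>r\<close> in the field R/m, written as an equation in R:
  the ideal \<open>rR + m\<close> is larger than \<open>m\<close> and so contains 1.\<close>

lemma (in cring) maximalideal_inverse:
  assumes "maximalideal m R" and r: "r \<in> carrier R" "r \<notin> m"
  obtains s p where "s \<in> carrier R" "p \<in> m" "s \<otimes> r \<oplus> p = \<one>"
proof -
  interpret m: maximalideal m R by fact
  define J where "J = PIdl r <+>\<^bsub>R\<^esub> m"
  have J: "ideal J R" unfolding J_def by (intro add_ideals cgenideal_ideal r m.is_ideal)
  interpret r: ideal "PIdl r" R by (rule cgenideal_ideal[OF r(1)])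
  have "x \<oplus> y \<in> J" if "x \<in> PIdl r" "y \<in> m" for x y
    using that by (auto simp: J_def set_add_def')
  from this[OF r.zero_closed] this[OF cgenideal_self[OF r(1)] m.zero_closed]
  have "m \<subseteq> J" "r \<in> J" using m.Icarr r(1) by auto
  moreover have "J \<subseteq> carrier R" using ideal.Icarr[OF J] by auto
  ultimately have "J = carrier R" using m.I_maximal[OF J] r(2) by metis
  then have "\<one> \<in> PIdl r <+>\<^bsub>R\<^esub> m" unfolding J_def by simp
  then obtain q p where "q \<in> PIdl r" "p \<in> m" "\<one> = q \<oplus> p"
    unfolding set_add_def' by blast
  moreover from this(1) obtain s where "s \<in> carrier R" "q = s \<otimes> r"
    unfolding cgenideal_def by blast
  ultimately show thesis using that by simp
qed

text \<open>A nonzero \<open>x\<close> killed by \<open>m\<close> generates a minimal ideal: a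
  nonzero multiple \<open>r x\<close> has \<open>r\<close> outside \<open>m\<close>, and an inverse
  of \<open>r\<close> modulo \<open>m\<close> recovers \<open>x\<close> from it.\<close>

lemma (in cring) annihilator_maximalideal_subset_socle:
  assumes "maximalideal m R"
  shows "{x \<in> carrier R. \<forall>p\<in>m. p \<otimes> x = \<zero>} \<subseteq> socle R"
proof
  fix x assume "x \<in> {x \<in> carrier R. \<forall>p\<in>m. p \<otimes> x = \<zero>}"
  then have x: "x \<in> carrier R" and px: "\<And>p. p \<in> m \<Longrightarrow> p \<otimes> x = \<zero>" by auto
  interpret m: maximalideal m R by fact
  interpret S: ideal "socle R" R by (rule socle_ideal[OF is_cring])
  show "x \<in> socle R"
  proof (cases "x = \<zero>")
    case False
    have "minimal_ideal (PIdl x) R" unfolding minimal_ideal_def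
    proof (intro conjI allI impI)
      show "ideal (PIdl x) R" by (rule cgenideal_ideal[OF x])
      show "PIdl x \<noteq> {\<zero>}" using cgenideal_self[OF x] False by auto
      fix J assume J: "ideal J R" "J \<subseteq> PIdl x"
      interpret J: ideal J R by fact
      show "J = {\<zero>} \<or> J = PIdl x"
      proof (cases "J \<subseteq> {\<zero>}")
        case True then show ?thesis using J.zero_closed by auto
      next
        case False
        then obtain y where y: "y \<in> J" "y \<noteq> \<zero>" by auto
        then obtain r where r: "r \<in> carrier R" "y = r \<otimes> x"
          using J(2) by (auto simp: cgenideal_def)
        then have "r \<notin> m" using px y by auto
        then obtain s p where sp: "s \<in> carrier R" "p \<in> m" "s \<otimes> r \<oplus> p = \<one>"
          using maximalideal_inverse[OF assms r(1)] by blast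
        have "x = (s \<otimes> r \<oplus> p) \<otimes> x" using sp(3) x by simp
        also have "\<dots> = s \<otimes> y" using sp(1) r x px[OF sp(2)] m.Icarr[OF sp(2)]
          by (simp add: l_distr m_assoc)
        finally have "x \<in> J" using J.I_l_closed[OF y(1) sp(1)] by simp
        then show ?thesis using cgenideal_minimal[OF J(1)] J(2) by blast
      qed
    qed
    then have "PIdl x \<subseteq> \<Union>{I. minimal_ideal I R}" by blast
    moreover have "\<Union>{I. minimal_ideal I R} \<subseteq> socle R" unfolding socle_def
      by (rule genideal_self) (auto simp: minimal_ideal_def dest: ideal.Icarr)
    ultimately show ?thesis using cgenideal_self[OF x] by blast
  qed simp
qed

text \<open>Let \<open>k\<close> be a maximal ideal that does not contain \<open>m\<close>, and pick
  \<open>p\<close> in \<open>m\<close> outside \<open>k\<close>. Then \<open>p x\<close> lies in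
  \<open>k\<close> while \<open>p\<close> is invertible modulo \<open>k\<close>, so \<open>x\<close>
  lies in \<open>k\<close>.\<close>

lemma (in cring) maximalideal_mem_jacobson_radical:
  assumes m: "maximalideal m R" and x: "x \<in> m"
    and mx: "\<And>p. p \<in> m \<Longrightarrow> p \<otimes> x \<in> jacobson_radical R"
  shows "x \<in> jacobson_radical R"
proof -
  interpret m: maximalideal m R by fact
  have "x \<in> k" if k: "maximalideal k R" for k
  proof (cases "m \<subseteq> k")
    case True
    interpret k: maximalideal k R by fact
    show ?thesis using True x by auto
  next
    case False
    interpret k: maximalideal k R by fact
    obtain p where p: "p \<in> m" "p \<notin> k" using False by auto
    obtain s q where sq: "s \<in> carrier R" "q \<in> k" "s \<otimes> p \<oplus> q = \<one>"
      using maximalideal_inverse[OF k m.Icarr[OF p(1)] p(2)] .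
    have carr: "p \<in> carrier R" "x \<in> carrier R" "q \<in> carrier R"
      using p x sq(2) m.Icarr k.Icarr by auto
    have "p \<otimes> x \<in> k" using mx[OF p(1)] k by (auto simp: jacobson_radical_def)
    then have "s \<otimes> (p \<otimes> x) \<oplus> q \<otimes> x \<in> k"
      using sq carr k.I_l_closed k.I_r_closed by auto
    also have "s \<otimes> (p \<otimes> x) \<oplus> q \<otimes> x = (s \<otimes> p \<oplus> q) \<otimes> x"
      using sq(1) carr by (simp add: l_distr m_assoc)
    finally show ?thesis using sq(3) carr by simp
  qed
  then show ?thesis using m.Icarr[OF x] by (auto simp: jacobson_radical_def)
qed

text \<open>The isomorphism \<open>h\<close> from R/Rad R to the socle gives each \<open>y\<close>
  in the annihilator a preimage class, with a chosen representative \<open>f y\<close>. Adding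
  elements of \<open>m\<close> to these representatives never produces a collision: if
  \<open>f y\<close> and \<open>f y'\<close> differ by an element of \<open>m\<close>, that
  difference is already in the radical. Since \<open>f\<close> need not be additive, the argument
  runs over differences.\<close>

lemma (in cring) frobenius_card_annihilator_maximalideal:
  assumes fin: "finite (carrier R)" and frob: "frobenius_ring R" and m: "maximalideal m R"
  shows "card {x \<in> carrier R. \<forall>p\<in>m. p \<otimes> x = \<zero>} * card m \<le> card (carrier R)"
proof -
  let ?ann = "{x \<in> carrier R. \<forall>p\<in>m. p \<otimes> x = \<zero>}"
  let ?J = "jacobson_radical R"
  interpret m: maximalideal m R by fact
  interpret J: ideal ?J R by (rule jacobson_radical_ideal[OF is_cring])
  obtain h where bij: "bij_betw h (carrier (R Quot ?J)) (socle R)"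
    and h_smult: "\<And>r Y. r \<in> carrier R \<Longrightarrow> Y \<in> carrier (R Quot ?J) \<Longrightarrow>
        h ((?J +> r) \<otimes>\<^bsub>R Quot ?J\<^esub> Y) = r \<otimes> h Y"
    using frob unfolding frobenius_ring_def module_isomorphic_def
    by (auto simp: quotient_module_def regular_module_def)
  have coset_carr: "?J +> x \<in> carrier (R Quot ?J)" if "x \<in> carrier R" for x
    using that by (simp add: FactRing_def a_rcosetsI[OF J.a_subset])
  have h_coset: "h (?J +> p \<otimes> x) = p \<otimes> h (?J +> x)" if "p \<in> carrier R" "x \<in> carrier R" for p x
    using h_smult[OF that(1) coset_carr[OF that(2)]] that
    by (simp add: FactRing_def J.rcoset_mult_add)
  have "\<exists>x\<in>carrier R. h (?J +> x) = y" if "y \<in> ?ann" for y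
  proof -
    have "y \<in> h ` carrier (R Quot ?J)"
      using that annihilator_maximalideal_subset_socle[OF m] bij by (auto simp: bij_betw_def)
    then show ?thesis by (auto simp: FactRing_def A_RCOSETS_def')
  qed
  then have "\<forall>y\<in>?ann. \<exists>x. x \<in> carrier R \<and> h (?J +> x) = y" by blast
  from bchoice[OF this] obtain f where "\<forall>y\<in>?ann. f y \<in> carrier R \<and> h (?J +> f y) = y" ..
  then have f: "f y \<in> carrier R" "h (?J +> f y) = y" if "y \<in> ?ann" for y using that by blast+
  have "inj_on (\<lambda>(y, p). f y \<oplus> p) (?ann \<times> m)"
  proof (rule inj_onI; clarify)
    fix y p y' p'
    assume y: "y \<in> carrier R" "\<forall>q\<in>m. q \<otimes> y = \<zero>" and p: "p \<in> m"
      and y': "y' \<in> carrier R" "\<forall>q\<in>m. q \<otimes> y' = \<zero>" and p': "p' \<in> m"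
      and eq: "f y \<oplus> p = f y' \<oplus> p'"
    have carr: "f y \<in> carrier R" "f y' \<in> carrier R" "p \<in> carrier R" "p' \<in> carrier R"
      using f(1)[of y] f(1)[of y'] y y' p p' m.Icarr by blast+
    define d where "d = f y \<ominus> f y'"
    have d: "d \<in> carrier R" using carr by (simp add: d_def)
    have "f y' \<oplus> d = f y"
      using carr a_comm[of "f y" "\<ominus> f y'"] by (simp add: d_def minus_eq r_neg2)
    then have "f y' \<oplus> (d \<oplus> p) = f y' \<oplus> p'" using eq carr d by (simp flip: a_assoc)
    then have "d \<oplus> p = p'" using carr d by simp
    then have "d = p' \<ominus> p" using carr d by (auto simp: minus_eq a_assoc r_neg)
    then have "d \<in> m" using p p' by (simp add: minus_eq m.a_closed m.a_inv_closed)
    \<comment> \<open>Under \<open>h\<close> the classes of \<open>q (f y)\<close> and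
      \<open>q (f y')\<close> go to \<open>q y = 0\<close> and \<open>q y' = 0\<close>, so by
      injectivity they coincide.\<close>
    moreover have "q \<otimes> d \<in> ?J" if q: "q \<in> m" for q
    proof -
      have qc: "q \<in> carrier R" using m.Icarr[OF q] .
      have z: "h (?J +> q \<otimes> f y) = \<zero>" "h (?J +> q \<otimes> f y') = \<zero>"
        using h_coset[OF qc] carr f(2)[of y] f(2)[of y'] y y' q by simp_all
      have "?J +> q \<otimes> f y = ?J +> q \<otimes> f y'"
        using inj_onD[OF bij_betw_imp_inj_on[OF bij], of "?J +> q \<otimes> f y" "?J +> q \<otimes> f y'"] z
          coset_carr qc carr by auto
      then have "q \<otimes> f y \<ominus> q \<otimes> f y' \<in> ?J"
        using quotient_eq_iff_same_a_r_cos[OF J.ideal_axioms, of "q \<otimes> f y" "q \<otimes> f y'"] qc carr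
        by auto
      also have "q \<otimes> f y \<ominus> q \<otimes> f y' = q \<otimes> d" unfolding d_def using qc carr by (simp add: minus_eq r_distr r_minus)
      finally show ?thesis .
    qed
    ultimately have "d \<in> ?J" by (rule maximalideal_mem_jacobson_radical[OF m])
    then have "?J +> f y = ?J +> f y'"
      using quotient_eq_iff_same_a_r_cos[OF J.ideal_axioms] carr by (auto simp: d_def)
    moreover have "h (?J +> f y) = y" "h (?J +> f y') = y'"
      using f(2)[of y] f(2)[of y'] y y' by blast+
    ultimately have "y = y'" by metis
    then show "y = y' \<and> p = p'" using eq carr by simp
  qed
  moreover have "(\<lambda>(y, p). f y \<oplus> p) ` (?ann \<times> m) \<subseteq> carrier R" using f(1) m.Icarr by auto
  ultimately have "card (?ann \<times> m) \<le> card (carrier R)" using fin by (rule card_inj_on_le)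
  then show ?thesis by (simp add: card_cartesian_product)
qed

section \<open>Duality for a symmetric bilinear form\<close>

text \<open>Counting along fibres stands in for quotient modules. In the applications
  \<open>f\<close> is additive, and subtracting a fixed point embeds its fibre into
  \<open>K\<close>; the embedding \<open>g\<close> may vary with the fibre.\<close>

lemma card_le_mult_fibre:
  assumes "finite A" "finite B" "finite K" and "f ` A \<subseteq> B"
    and fibre: "\<And>x. x \<in> A \<Longrightarrow> \<exists>g. inj_on g {x' \<in> A. f x' = f x} \<and> g ` {x' \<in> A. f x' = f x} \<subseteq> K"
  shows "card A \<le> card B * card K"
proof -
  have "A = (\<Union>y\<in>f ` A. {x' \<in> A. f x' = y})" by auto
  then have "card A \<le> (\<Sum>y\<in>f ` A. card {x' \<in> A. f x' = y})"
    using card_UN_le[of "f ` A" "\<lambda>y. {x' \<in> A. f x' = y}"] \<open>finite A\<close> by simp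
  also have "\<dots> \<le> card (f ` A) * card K"
    using sum_bounded_above[of "f ` A" "\<lambda>y. card {x' \<in> A. f x' = y}" "card K"]
      fibre card_inj_on_le[OF _ _ \<open>finite K\<close>] by fastforce
  also have "\<dots> \<le> card B * card K" using assms by (simp add: card_mono)
  finally show ?thesis .
qed

section \<open>Submodules and simple quotients\<close>

lemma (in module) submodule_zero_closed:
  assumes "submodule H R M" shows "\<zero>\<^bsub>M\<^esub> \<in> H"
  using subgroup.one_closed[OF submodule.axioms(1)[OF assms]] by simp

lemma (in module) submodule_minus_closed:
  assumes "submodule H R M" "u \<in> H" "v \<in> H" shows "u \<ominus>\<^bsub>M\<^esub> v \<in> H"
  using submoduleE[OF assms(1)] assms by (simp add: M.minus_eq)

lemma (in abelian_group) add_eq_imp_eq_minus: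
  assumes "u \<in> carrier G" "v \<in> carrier G" "w \<in> carrier G" and "u \<oplus> v = w"
  shows "v = w \<ominus> u"
  using assms by (metis minus_eq a_comm r_neg1 a_inv_closed)

text \<open>If \<open>E\<close> is maximal among the proper submodules of \<open>D\<close> and \<open>d \<in> D - E\<close>, then \<open>m\<close> is the
  annihilator of the simple module \<open>D / E\<close>, which is generated by the class of \<open>d\<close>.\<close>

lemma (in module) maximal_submodule:
  assumes E: "submodule E R M" "E \<subset> D" and D: "submodule D R M"
    and max: "\<And>F. submodule F R M \<Longrightarrow> E \<subset> F \<Longrightarrow> F \<subseteq> D \<Longrightarrow> F = D"
    and d: "d \<in> D" "d \<notin> E"
  defines "m \<equiv> {r \<in> carrier R. r \<odot>\<^bsub>M\<^esub> d \<in> E}"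
  shows "maximalideal m R"
proof -
  note Ecl = submoduleE[OF E(1)] submodule_zero_closed[OF E(1)]
  note Dcl = submoduleE[OF D] submodule_zero_closed[OF D]
  have dc: "d \<in> carrier M" using d Dcl(1) by auto
  have m: "ideal m R"
  proof (rule idealI[OF R.ring_axioms])
    show "subgroup m (add_monoid R)"
    proof (rule R.add.subgroupI)
      show "m \<noteq> {}" using Ecl(7) dc by (auto simp: m_def intro!: exI[of _ \<zero>])
      show "\<ominus> r \<in> m" if "r \<in> m" for r using that Ecl(3) dc by (auto simp: m_def smult_l_minus)
      show "r \<oplus> s \<in> m" if "r \<in> m" "s \<in> m" for r s
        using that Ecl(5) dc by (auto simp: m_def smult_l_distr)
    qed (auto simp: m_def)
    show "x \<otimes> r \<in> m" if "r \<in> m" "x \<in> carrier R" for r x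
      using that Ecl(4) dc by (auto simp: m_def smult_assoc1)
    then show "r \<otimes> x \<in> m" if "r \<in> m" "x \<in> carrier R" for r x
      using that by (auto simp: m_comm[of r x] m_def)
  qed
  show ?thesis
  proof (rule maximalidealI[OF m])
    show "carrier R \<noteq> m" using d dc by (auto simp: m_def set_eq_iff intro!: exI[of _ \<one>])
    fix J assume J: "ideal J R" "m \<subseteq> J" "J \<subseteq> carrier R"
    interpret J: ideal J R by fact
    show "J = m \<or> J = carrier R"
    proof (cases "J \<subseteq> m")
      case False
      then obtain r where r: "r \<in> J" "r \<notin> m" by auto
      have rc: "r \<in> carrier R" using r J by auto
      define w where "w = r \<odot>\<^bsub>M\<^esub> d"
      have w: "w \<in> D" "w \<notin> E" "w \<in> carrier M" using r rc d dc Dcl(4) by (auto simp: w_def m_def)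
      \<comment> \<open>\<open>F\<close> is \<open>E + Rw\<close>, which properly contains
        \<open>E\<close> and hence equals \<open>D\<close>. Writing \<open>d = e + s w\<close> with
        \<open>w = r d\<close> puts \<open>1 - s r\<close> into \<open>m\<close>, hence into
        \<open>J\<close>; as \<open>r\<close> is in \<open>J\<close>, so is 1.\<close>
      define F where "F = {e \<oplus>\<^bsub>M\<^esub> s \<odot>\<^bsub>M\<^esub> w | e s. e \<in> E \<and> s \<in> carrier R}"
      have F_I: "e \<oplus>\<^bsub>M\<^esub> s \<odot>\<^bsub>M\<^esub> w \<in> F" if "e \<in> E" "s \<in> carrier R" for e s
        using that by (auto simp: F_def)
      have Ec: "e \<in> carrier M" if "e \<in> E" for e using that Ecl(1) by auto
      have "submodule F R M"
      proof (rule submoduleI)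
        show "F \<subseteq> carrier M" using Ec w(3) by (auto simp: F_def)
        show "\<zero>\<^bsub>M\<^esub> \<in> F" using F_I[OF Ecl(7) R.zero_closed] w(3) by simp
        show "\<ominus>\<^bsub>M\<^esub> x \<in> F" if "x \<in> F" for x
        proof -
          obtain e s where es: "e \<in> E" "s \<in> carrier R" "x = e \<oplus>\<^bsub>M\<^esub> s \<odot>\<^bsub>M\<^esub> w"
            using \<open>x \<in> F\<close> by (auto simp: F_def)
          then have "\<ominus>\<^bsub>M\<^esub> x = \<ominus>\<^bsub>M\<^esub> e \<oplus>\<^bsub>M\<^esub> (\<ominus> s) \<odot>\<^bsub>M\<^esub> w"
            using Ec w(3) by (simp add: M.minus_add smult_l_minus M.a_comm)
          then show ?thesis using F_I[of "\<ominus>\<^bsub>M\<^esub> e" "\<ominus> s"] Ecl(3) es by simp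
        qed
        show "x \<oplus>\<^bsub>M\<^esub> y \<in> F" if "x \<in> F" "y \<in> F" for x y
        proof -
          obtain e s where es: "e \<in> E" "s \<in> carrier R" "x = e \<oplus>\<^bsub>M\<^esub> s \<odot>\<^bsub>M\<^esub> w"
            using \<open>x \<in> F\<close> by (auto simp: F_def)
          obtain e' s' where es': "e' \<in> E" "s' \<in> carrier R" "y = e' \<oplus>\<^bsub>M\<^esub> s' \<odot>\<^bsub>M\<^esub> w"
            using \<open>y \<in> F\<close> by (auto simp: F_def)
          have "x \<oplus>\<^bsub>M\<^esub> y = (e \<oplus>\<^bsub>M\<^esub> e') \<oplus>\<^bsub>M\<^esub> (s \<oplus> s') \<odot>\<^bsub>M\<^esub> w"
            using es es' Ec w(3) by (simp add: smult_l_distr M.a_ac)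
          then show ?thesis using F_I Ecl(5) es es' by simp
        qed
        show "q \<odot>\<^bsub>M\<^esub> x \<in> F" if "q \<in> carrier R" "x \<in> F" for q x
        proof -
          obtain e s where es: "e \<in> E" "s \<in> carrier R" "x = e \<oplus>\<^bsub>M\<^esub> s \<odot>\<^bsub>M\<^esub> w"
            using \<open>x \<in> F\<close> by (auto simp: F_def)
          then have "q \<odot>\<^bsub>M\<^esub> x = q \<odot>\<^bsub>M\<^esub> e \<oplus>\<^bsub>M\<^esub> (q \<otimes> s) \<odot>\<^bsub>M\<^esub> w"
            using Ec w(3) that by (simp add: smult_r_distr smult_assoc1)
          then show ?thesis using F_I Ecl(4) es that by simp
        qed
      qed
      moreover have "E \<subset> F"
      proof -
        have "E \<subseteq> F" using F_I[OF _ R.zero_closed] w(3) Ec by force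
        moreover have "w \<in> F" using F_I[OF Ecl(7) one_closed] w(3) by simp
        ultimately show ?thesis using w(2) by auto
      qed
      moreover have "F \<subseteq> D" using Dcl(4,5) E(2) w(1) by (auto simp: F_def)
      ultimately have "d \<in> F" using max d(1) by blast
      then obtain e s where es: "e \<in> E" "s \<in> carrier R" "d = e \<oplus>\<^bsub>M\<^esub> s \<odot>\<^bsub>M\<^esub> w"
        by (auto simp: F_def)
      have sr: "(s \<otimes> r) \<odot>\<^bsub>M\<^esub> d = s \<odot>\<^bsub>M\<^esub> w" using es(2) rc dc by (simp add: w_def smult_assoc1)
      have "(\<one> \<ominus> s \<otimes> r) \<odot>\<^bsub>M\<^esub> d = d \<ominus>\<^bsub>M\<^esub> s \<odot>\<^bsub>M\<^esub> w"
        using es(2) rc dc w(3) by (simp add: R.minus_eq M.minus_eq smult_l_distr smult_l_minus sr)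
      also have "\<dots> = e"
        using M.add_eq_imp_eq_minus[of "s \<odot>\<^bsub>M\<^esub> w" e d] es dc w(3) Ec by (simp add: M.a_comm)
      finally have "\<one> \<ominus> s \<otimes> r \<in> m" using es(1,2) rc by (simp add: m_def)
      then have "(\<one> \<ominus> s \<otimes> r) \<oplus> s \<otimes> r \<in> J"
        using J(2) J.I_l_closed[OF r(1) es(2)] J.a_closed by blast
      also have "(\<one> \<ominus> s \<otimes> r) \<oplus> s \<otimes> r = \<one>" using es(2) rc by (simp add: R.minus_eq R.a_assoc R.l_neg)
      finally show ?thesis using J.one_imp_carrier by simp
    qed (use J in auto)
  qed
qed

section \<open>Orthogonality and the counting identity\<close>

locale symmetric_form = module +
  fixes b
  assumes form_closed: "u \<in> carrier M \<Longrightarrow> v \<in> carrier M \<Longrightarrow> b u v \<in> carrier R"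
    and form_commute: "u \<in> carrier M \<Longrightarrow> v \<in> carrier M \<Longrightarrow> b u v = b v u"
    and form_add: "u \<in> carrier M \<Longrightarrow> v \<in> carrier M \<Longrightarrow> w \<in> carrier M \<Longrightarrow>
      b u (v \<oplus>\<^bsub>M\<^esub> w) = b u v \<oplus> b u w"
    and form_smult: "u \<in> carrier M \<Longrightarrow> v \<in> carrier M \<Longrightarrow> r \<in> carrier R \<Longrightarrow>
      b u (r \<odot>\<^bsub>M\<^esub> v) = r \<otimes> b u v"
begin

definition orthogonal where
  "orthogonal C = {v \<in> carrier M. \<forall>u\<in>C. b u v = \<zero>}"

lemma form_zero: "u \<in> carrier M \<Longrightarrow> b u \<zero>\<^bsub>M\<^esub> = \<zero>"
  using form_smult[of u "\<zero>\<^bsub>M\<^esub>" \<zero>] form_closed[of u "\<zero>\<^bsub>M\<^esub>"] by simp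

lemma form_uminus: "u \<in> carrier M \<Longrightarrow> v \<in> carrier M \<Longrightarrow> b u (\<ominus>\<^bsub>M\<^esub> v) = \<ominus> b u v"
  using form_smult[of u v "\<ominus> \<one>"] form_closed[of u v] by (simp add: smult_l_minus l_minus)

lemma form_minus:
  "u \<in> carrier M \<Longrightarrow> v \<in> carrier M \<Longrightarrow> w \<in> carrier M \<Longrightarrow> b u (v \<ominus>\<^bsub>M\<^esub> w) = b u v \<ominus> b u w"
  by (simp add: M.minus_eq R.minus_eq form_add form_uminus)

lemma submodule_orthogonal:
  assumes "C \<subseteq> carrier M" shows "submodule (orthogonal C) R M"
proof (rule submoduleI)
  show "r \<odot>\<^bsub>M\<^esub> x \<in> orthogonal C" if "r \<in> carrier R" "x \<in> orthogonal C" for r x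
    using that assms by (auto simp: orthogonal_def form_smult subset_iff)
qed (use assms in \<open>auto simp: orthogonal_def form_zero form_uminus form_add subset_iff\<close>)

lemma submodule_Int:
  assumes "submodule C R M" "submodule D R M" shows "submodule (C \<inter> D) R M"
  by (rule submoduleI)
    (use submoduleE[OF assms(1)] submoduleE[OF assms(2)] submodule_zero_closed[OF assms(1)]
      submodule_zero_closed[OF assms(2)] in auto)

text \<open>Induction on \<open>D\<close>: passing to a maximal submodule \<open>E\<close> that still contains \<open>D \<inter> orthogonal C\<close>
  divides \<open>card D\<close> by \<open>card (R / m)\<close> for a maximal ideal \<open>m\<close>, whereas pairing with an element of
  \<open>D - E\<close> embeds \<open>(C \<inter> orthogonal E) / (C \<inter> orthogonal D)\<close> into the annihilator of \<open>m\<close>.\<close>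

lemma card_orthogonal_le:
  assumes finR: "finite (carrier R)" and finM: "finite (carrier M)" and frob: "frobenius_ring R"
    and C: "submodule C R M" and "submodule D R M"
  shows "card C * card (D \<inter> orthogonal C) \<le> card D * card (C \<inter> orthogonal D)"
  using assms(5)
proof (induction "card D" arbitrary: D rule: less_induct)
  case (less D)
  note D = less.prems
  note Ccl = submoduleE[OF C] and Dcl = submoduleE[OF D]
  have finC: "finite C" using Ccl(1) finM by (rule finite_subset)
  have finD: "finite D" using Dcl(1) finM by (rule finite_subset)
  show ?case
  proof (cases "D \<subseteq> orthogonal C")
    case True
    then have "C \<subseteq> orthogonal D" using Ccl(1) Dcl(1) form_commute
      by (auto simp: orthogonal_def subset_iff)
    with True show ?thesis by (simp add: Int_absorb2)
  next
    case False
    \<comment> \<open>Requiring \<open>E\<close> to contain \<open>D \<inter> orthogonal C\<close>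
      ensures that passing from \<open>D\<close> to \<open>E\<close> leaves the intersection with
      \<open>orthogonal C\<close> unchanged. Every submodule between \<open>E\<close> and a proper
      part of \<open>D\<close> is again in \<open>S\<close>, so maximality in \<open>S\<close> is
      maximality among the proper submodules of \<open>D\<close>.\<close>
    define S where "S = {E. submodule E R M \<and> D \<inter> orthogonal C \<subseteq> E \<and> E \<subset> D}"
    have "finite S" using finD by (auto intro: finite_subset[of _ "Pow D"] simp: S_def)
    moreover have "D \<inter> orthogonal C \<in> S"
      using False submodule_Int[OF D submodule_orthogonal[OF Ccl(1)]] by (auto simp: S_def)
    ultimately obtain E where "E \<in> S" and max: "\<And>F. F \<in> S \<Longrightarrow> E \<subseteq> F \<Longrightarrow> F = E"
      using finite_has_maximal[of S] by auto
    then have E: "submodule E R M" "D \<inter> orthogonal C \<subseteq> E" "E \<subset> D" by (auto simp: S_def)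
    note Ecl = submoduleE[OF E(1)]
    have finE: "finite E" using Ecl(1) finM by (rule finite_subset)
    obtain d where d: "d \<in> D" "d \<notin> E" using E(3) by auto
    have dc: "d \<in> carrier M" using d Dcl(1) by auto
    define m where "m = {r \<in> carrier R. r \<odot>\<^bsub>M\<^esub> d \<in> E}"
    have m: "maximalideal m R" unfolding m_def
      by (rule maximal_submodule[OF E(1,3) D _ d]) (use max E(2) in \<open>auto simp: S_def\<close>)
    have mI: "r \<in> m" if "r \<in> carrier R" "r \<odot>\<^bsub>M\<^esub> d \<in> E" for r using that by (simp add: m_def)
    have mD: "r \<in> carrier R" "r \<odot>\<^bsub>M\<^esub> d \<in> E" if "r \<in> m" for r using that by (simp_all add: m_def)
    define A where "A = {x \<in> carrier R. \<forall>p\<in>m. p \<otimes> x = \<zero>}"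
    have finm: "finite m" using mD(1) by (auto intro: finite_subset[OF _ finR])
    have finA: "finite A" unfolding A_def using finR by (rule rev_finite_subset) blast
    \<comment> \<open>Division-free form of |D/E| \<ge> |R/m|. In a fibre of \<open>(e, r)\<close>
      going to \<open>e + r d\<close>, the second component determines the first, and two second
      components differ by an element of \<open>m\<close>.\<close>
    have "card (E \<times> carrier R) \<le> card D * card m"
    proof (rule card_le_mult_fibre[where f = "\<lambda>(e, r). e \<oplus>\<^bsub>M\<^esub> r \<odot>\<^bsub>M\<^esub> d"])
      show "(\<lambda>(e, r). e \<oplus>\<^bsub>M\<^esub> r \<odot>\<^bsub>M\<^esub> d) ` (E \<times> carrier R) \<subseteq> D"
        using E(3) Dcl(4,5) d(1) by auto
      fix x assume "x \<in> E \<times> carrier R"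
      then obtain e r where x: "x = (e, r)" "e \<in> E" "r \<in> carrier R" by auto
      let ?F = "{x' \<in> E \<times> carrier R. (case x' of (e, r) \<Rightarrow> e \<oplus>\<^bsub>M\<^esub> r \<odot>\<^bsub>M\<^esub> d)
        = (case x of (e, r) \<Rightarrow> e \<oplus>\<^bsub>M\<^esub> r \<odot>\<^bsub>M\<^esub> d)}"
      have F: "e' \<in> E" "r' \<in> carrier R" "e' \<in> carrier M" "e' \<oplus>\<^bsub>M\<^esub> r' \<odot>\<^bsub>M\<^esub> d = e \<oplus>\<^bsub>M\<^esub> r \<odot>\<^bsub>M\<^esub> d"
        if "(e', r') \<in> ?F" for e' r'
        using that Ecl(1) x by auto
      have ec: "e \<in> carrier M" using x Ecl(1) by auto
      have "inj_on (\<lambda>(e', r'). r' \<ominus> r) ?F"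
      proof (rule inj_onI)
        fix x1 x2
        assume x12: "x1 \<in> ?F" "x2 \<in> ?F"
          and eq': "(case x1 of (e', r') \<Rightarrow> r' \<ominus> r) = (case x2 of (e', r') \<Rightarrow> r' \<ominus> r)"
        obtain e1 r1 e2 r2 where x12': "x1 = (e1, r1)" "x2 = (e2, r2)" by (cases x1, cases x2) auto
        note F1 = F[OF x12(1)[unfolded x12']] and F2 = F[OF x12(2)[unfolded x12']]
        have eq: "r1 \<ominus> r = r2 \<ominus> r" using eq' by (simp add: x12')
        have "r1 = r2" using eq F1 F2 x by (simp add: R.minus_eq)
        moreover have "e1 \<oplus>\<^bsub>M\<^esub> r2 \<odot>\<^bsub>M\<^esub> d = e2 \<oplus>\<^bsub>M\<^esub> r2 \<odot>\<^bsub>M\<^esub> d" using F1(4) F2(4) calculation by simp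
        then have "e1 = e2" using F1(3) F2(2,3) dc by simp
        ultimately show "x1 = x2" by (simp add: x12')
      qed
      moreover have "(\<lambda>(e', r'). r' \<ominus> r) ` ?F \<subseteq> m"
      proof (rule image_subsetI)
        fix x' assume x': "x' \<in> ?F"
        obtain e' r' where er: "x' = (e', r')" by (cases x')
        note F' = F[OF x'[unfolded er]]
        have "r' \<odot>\<^bsub>M\<^esub> d = (e \<oplus>\<^bsub>M\<^esub> r \<odot>\<^bsub>M\<^esub> d) \<ominus>\<^bsub>M\<^esub> e'"
          using M.add_eq_imp_eq_minus[OF _ _ _ F'(4)] F' ec x dc by simp
        then have "(r' \<ominus> r) \<odot>\<^bsub>M\<^esub> d = (e \<oplus>\<^bsub>M\<^esub> r \<odot>\<^bsub>M\<^esub> d) \<ominus>\<^bsub>M\<^esub> e' \<ominus>\<^bsub>M\<^esub> r \<odot>\<^bsub>M\<^esub> d"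
          using F'(2) x(3) dc by (simp add: R.minus_eq M.minus_eq smult_l_distr smult_l_minus)
        also have "\<dots> = e \<ominus>\<^bsub>M\<^esub> e'"
          using F'(3) ec x(3) dc M.a_comm[of "\<ominus>\<^bsub>M\<^esub> e'" "\<ominus>\<^bsub>M\<^esub> (r \<odot>\<^bsub>M\<^esub> d)"]
          by (simp add: M.minus_eq M.a_assoc M.r_neg2)
        finally have "r' \<ominus> r \<in> m"
          using submodule_minus_closed[OF E(1) x(2) F'(1)] F'(2) x(3) by (intro mI) simp_all
        then show "(case x' of (e', r') \<Rightarrow> r' \<ominus> r) \<in> m" by (simp add: er)
      qed
      ultimately show "\<exists>g. inj_on g ?F \<and> g ` ?F \<subseteq> m" by blast
    qed (use finE finR finD finm in auto)
    then have card_E: "card E * card (carrier R) \<le> card D * card m"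
      by (simp add: card_cartesian_product)
    \<comment> \<open>Values \<open>b c d\<close> are killed by \<open>m\<close>, because
      \<open>m d\<close> lies in \<open>E\<close> and \<open>c\<close> is orthogonal to
      \<open>E\<close>.\<close>
    have "card (C \<inter> orthogonal E) \<le> card A * card (C \<inter> orthogonal D)"
    proof (rule card_le_mult_fibre[where f = "\<lambda>c. b c d"])
      have "p \<otimes> b c d = \<zero>" if "c \<in> C" "c \<in> orthogonal E" "p \<in> m" for c p
      proof -
        have "c \<in> carrier M" using that Ccl by auto
        then have "p \<otimes> b c d = b (p \<odot>\<^bsub>M\<^esub> d) c"
          using that(3) dc mD(1) form_smult[of c d p] form_commute[of c "p \<odot>\<^bsub>M\<^esub> d"] by simp
        then show ?thesis using that mD(2) by (simp add: orthogonal_def)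
      qed
      then show "(\<lambda>c. b c d) ` (C \<inter> orthogonal E) \<subseteq> A"
        using Ccl(1) dc by (auto simp: A_def intro: form_closed)
      fix c assume c: "c \<in> C \<inter> orthogonal E"
      let ?F = "{c' \<in> C \<inter> orthogonal E. b c' d = b c d}"
      have cc: "c' \<in> carrier M" if "c' \<in> C" for c' using that Ccl(1) by auto
      have "inj_on (\<lambda>c'. c' \<ominus>\<^bsub>M\<^esub> c) ?F"
        by (rule inj_onI) (use cc c in \<open>auto simp: M.minus_eq\<close>)
      moreover have "c' \<ominus>\<^bsub>M\<^esub> c \<in> C \<inter> orthogonal D" if c': "c' \<in> ?F" for c'
      proof -
        let ?w = "c' \<ominus>\<^bsub>M\<^esub> c"
        have wC: "?w \<in> C" using submodule_minus_closed[OF C] c c' by blast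
        have wE: "?w \<in> orthogonal E"
          using submodule_minus_closed[OF submodule_orthogonal[OF Ecl(1)]] c c' by blast
        \<comment> \<open>\<open>K\<close> contains both \<open>E\<close> and \<open>d\<close>, so
          by maximality it is all of \<open>D\<close>: orthogonality of \<open>?w\<close> to
          \<open>E\<close> and to the single element \<open>d\<close> gives orthogonality to
          \<open>D\<close>.\<close>
        define K where "K = D \<inter> orthogonal {?w}"
        have K: "submodule K R M" unfolding K_def
          by (intro submodule_Int D submodule_orthogonal) (use cc[OF wC] in auto)
        have "E \<subseteq> K" using wE E(3) Ecl(1) cc[OF wC] form_commute
          by (auto simp: K_def orthogonal_def subset_iff)
        moreover have "b ?w d = \<zero>"
        proof -
          have "b ?w d = b d c' \<ominus> b d c"
            using form_commute[of ?w d] form_minus[of d c' c] cc c c' dc wC by auto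
          also have "\<dots> = \<zero>"
            using form_commute[of d c'] form_commute[of d c] form_closed[of c d] c c' cc dc
            by (auto simp: R.minus_eq R.r_neg)
          finally show ?thesis .
        qed
        then have "d \<in> K" using d dc by (auto simp: K_def orthogonal_def)
        moreover have "K \<subseteq> D" by (auto simp: K_def)
        ultimately have "K = D" using max[of K] K d E(2) by (auto simp: S_def)
        then show ?thesis using wC cc[OF wC] Dcl(1) form_commute
          by (fastforce simp: K_def orthogonal_def)
      qed
      ultimately show "\<exists>g. inj_on g ?F \<and> g ` ?F \<subseteq> C \<inter> orthogonal D" by blast
    qed (use finC finA in auto)
    note card_C = this
    have "D \<inter> orthogonal C = E \<inter> orthogonal C" using E by auto
    moreover have "card C * card (E \<inter> orthogonal C) \<le> card E * card (C \<inter> orthogonal E)"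
      using less.hyps[OF psubset_card_mono[OF finD E(3)] E(1)] .
    \<comment> \<open>The factor \<open>card (carrier R)\<close> allows the index estimates to be
      combined without division; it is positive and cancels at the end.\<close>
    ultimately have "card C * card (D \<inter> orthogonal C) * card (carrier R)
        \<le> card E * card (C \<inter> orthogonal E) * card (carrier R)" by simp
    also have "\<dots> = (card E * card (carrier R)) * card (C \<inter> orthogonal E)" by simp
    also have "\<dots> \<le> (card D * card m) * (card A * card (C \<inter> orthogonal D))"
      by (intro mult_mono card_E card_C) auto
    also have "\<dots> = card D * card (C \<inter> orthogonal D) * (card A * card m)" by simp
    also have "\<dots> \<le> card D * card (C \<inter> orthogonal D) * card (carrier R)"
      using frobenius_card_annihilator_maximalideal[OF finR frob m] by (simp add: A_def)
    finally show ?thesis using R.zero_closed finR by (metis card_gt_0_iff empty_iff mult_le_cancel2)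
  qed
qed

text \<open>The pairing of \<open>C\<close> with \<open>D\<close> becomes nondegenerate on both
  sides after dividing out \<open>C \<inter> orthogonal D\<close> and
  \<open>D \<inter> orthogonal C\<close>; the identity says that the two quotients have equal size.
  Exchanging \<open>C\<close> and \<open>D\<close> reverses the inequality.\<close>

theorem card_orthogonal:
  assumes "finite (carrier R)" "finite (carrier M)" "frobenius_ring R"
    and "submodule C R M" "submodule D R M"
  shows "card C * card (D \<inter> orthogonal C) = card D * card (C \<inter> orthogonal D)"
  using card_orthogonal_le[OF assms] card_orthogonal_le[OF assms(1-3,5,4)] by (rule antisym)

end

section \<open>Codes\<close>

lemma (in cring) symmetric_form_dot: "symmetric_form R (free_module R n) (dot R n)"
proof -
  interpret M: module R "free_module R n" by (rule free_module_is_module[OF is_cring])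
  have carr: "u l \<in> carrier R" if "u \<in> carrier (free_module R n)" "l \<in> {1..n}" for u l
    using that by (auto simp: free_module_def)
  show ?thesis
  proof (unfold_locales, goal_cases)
    case (1 u v)
    then show ?case by (auto simp: dot_def carr intro!: finsum_closed)
  next
    case (2 u v)
    then show ?case by (auto simp: dot_def carr m_comm intro!: finsum_cong')
  next
    case (3 u v w)
    have "dot R n u (v \<oplus>\<^bsub>free_module R n\<^esub> w) =
        (\<Oplus>l\<in>{1..n}. u l \<otimes> v l \<oplus> u l \<otimes> w l)"
      unfolding dot_def using 3 by (intro finsum_cong') (auto simp: carr free_module_def r_distr)
    also have "\<dots> = dot R n u v \<oplus> dot R n u w"
      unfolding dot_def using 3 by (intro finsum_addf) (auto simp: carr)
    finally show ?case .
  next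
    case (4 u v r)
    have "dot R n u (r \<odot>\<^bsub>free_module R n\<^esub> v) = (\<Oplus>l\<in>{1..n}. r \<otimes> (u l \<otimes> v l))"
      unfolding dot_def using 4 by (intro finsum_cong') (auto simp: carr free_module_def m_lcomm)
    also have "\<dots> = r \<otimes> dot R n u v"
      unfolding dot_def using 4 by (intro finsum_rdistr[symmetric]) (auto simp: carr)
    finally show ?case .
  qed
qed

section \<open>Products of principal ideals as codes\<close>

lemma (in cring) submodule_PiE_ideals:
  assumes I: "\<And>l. l \<in> {1..n} \<Longrightarrow> ideal (I l) R"
  shows "submodule (PiE {1..n} I) R (free_module R n)"
proof -
  interpret M: module R "free_module R n" by (rule free_module_is_module[OF is_cring])
  have Icarr: "x \<in> carrier R" if "l \<in> {1..n}" "x \<in> I l" for x l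
    using ideal.Icarr[OF I] that by blast
  have smult: "r \<odot>\<^bsub>free_module R n\<^esub> x \<in> PiE {1..n} I" if "r \<in> carrier R" "x \<in> PiE {1..n} I" for r x
    using that(1) ideal.I_l_closed[OF I PiE_mem[OF that(2)]] by (simp add: free_module_def PiE_iff)
  have sub: "PiE {1..n} I \<subseteq> carrier (free_module R n)"
    using Icarr by (auto simp: free_module_def PiE_iff)
  show ?thesis
  proof (rule M.submoduleI[OF sub _ _ _ smult])
    show "\<zero>\<^bsub>free_module R n\<^esub> \<in> PiE {1..n} I"
      using additive_subgroup.zero_closed[OF ideal.axioms(1)[OF I]] by (auto simp: free_module_def)
    show "x \<oplus>\<^bsub>free_module R n\<^esub> y \<in> PiE {1..n} I" if "x \<in> PiE {1..n} I" "y \<in> PiE {1..n} I" for x y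
      using that additive_subgroup.a_closed[OF ideal.axioms(1)[OF I]]
      by (auto simp: free_module_def PiE_iff)
    show "\<ominus>\<^bsub>free_module R n\<^esub> x \<in> PiE {1..n} I" if "x \<in> PiE {1..n} I" for x
    proof -
      \<comment> \<open>Writing the negative as a scalar multiple makes it pointwise, so that
        closure under scalars applies.\<close>
      have "\<ominus>\<^bsub>free_module R n\<^esub> x = (\<ominus> \<one>) \<odot>\<^bsub>free_module R n\<^esub> x"
        using that sub M.smult_l_minus[of \<one> x] by auto
      then show ?thesis using smult[OF _ that, of "\<ominus> \<one>"] by simp
    qed
  qed
qed

lemma (in cring) PIdl_subset_principal_dual_iff:
  assumes "r \<in> carrier R" "s \<in> carrier R"
  shows "PIdl r \<subseteq> principal_dual R s \<longleftrightarrow> s \<otimes> r = \<zero>"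
proof
  assume "PIdl r \<subseteq> principal_dual R s"
  then show "s \<otimes> r = \<zero>" using cgenideal_self[OF assms(1)] by (auto simp: principal_dual_def)
next
  assume eq: "s \<otimes> r = \<zero>"
  have "s \<otimes> (x \<otimes> r) = \<zero>" if "x \<in> carrier R" for x
    using m_lcomm[OF assms(2) that assms(1)] that eq by simp
  then show "PIdl r \<subseteq> principal_dual R s"
    using assms by (auto simp: cgenideal_def principal_dual_def)
qed

lemma (in cring) dual_code_PiE_PIdl:
  assumes b: "\<And>l. l \<in> {1..n} \<Longrightarrow> b l \<in> carrier R"
  shows "dual_code R n (PiE {1..n} (\<lambda>l. PIdl (b l))) = PiE {1..n} (\<lambda>l. principal_dual R (b l))"
proof (intro equalityI subsetI)
  fix v assume v: "v \<in> dual_code R n (PiE {1..n} (\<lambda>l. PIdl (b l)))"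
  have carr: "v l \<in> carrier R" if "l \<in> {1..n}" for l
    using v that by (auto simp: dual_code_def free_module_def)
  have "b l \<otimes> v l = \<zero>" if l: "l \<in> {1..n}" for l
  proof -
    \<comment> \<open>A codeword supported at position \<open>l\<close> alone isolates the summand
      \<open>b l \<otimes> v l\<close> of the dot product.\<close>
    define u where "u = (\<lambda>k\<in>{1..n}. if l = k then b k else \<zero>)"
    have zero: "\<zero> \<in> PIdl (b k)" if "k \<in> {1..n}" for k
      using additive_subgroup.zero_closed[OF ideal.axioms(1)[OF cgenideal_ideal[OF b[OF that]]]] .
    have "u \<in> PiE {1..n} (\<lambda>l. PIdl (b l))"
      using cgenideal_self[OF b] zero by (auto simp: u_def)
    then have "dot R n u v = \<zero>" using v by (auto simp: dual_code_def)
    moreover have "dot R n u v = (\<Oplus>k\<in>{1..n}. if l = k then b k \<otimes> v k else \<zero>)"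
      unfolding dot_def using b carr by (intro finsum_cong') (auto simp: u_def)
    moreover have "\<dots> = b l \<otimes> v l" using l b carr by (intro finsum_singleton) auto
    ultimately show ?thesis by simp
  qed
  then show "v \<in> PiE {1..n} (\<lambda>l. principal_dual R (b l))"
    using v carr by (auto simp: dual_code_def free_module_def principal_dual_def PiE_iff)
next
  fix v assume v: "v \<in> PiE {1..n} (\<lambda>l. principal_dual R (b l))"
  have v_carr: "v l \<in> carrier R" "b l \<otimes> v l = \<zero>" if "l \<in> {1..n}" for l
    using v that by (auto simp: principal_dual_def)
  have "dot R n u v = \<zero>" if u: "u \<in> PiE {1..n} (\<lambda>l. PIdl (b l))" for u
  proof -
    have "u l \<otimes> v l = \<zero>" if l: "l \<in> {1..n}" for l
    proof -
      obtain x where "x \<in> carrier R" "u l = x \<otimes> b l"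
        using PiE_mem[OF u l] by (auto simp: cgenideal_def)
      then show ?thesis using b[OF l] v_carr[OF l] by (simp add: m_assoc)
    qed
    then have "dot R n u v = (\<Oplus>l\<in>{1..n}. \<zero>)" unfolding dot_def by (intro finsum_cong') auto
    then show ?thesis by simp
  qed
  then show "v \<in> dual_code R n (PiE {1..n} (\<lambda>l. PIdl (b l)))"
    using v v_carr by (auto simp: dual_code_def free_module_def PiE_iff)
qed

text \<open>The counting identity for the product code of the ideals \<open>PIdl (b l)\<close>,
  whose dual is the product of their annihilators. For \<open>b l = a (J l)\<close> it compares the
  coefficients of the two enumerators.\<close>

lemma (in cring) card_dual_code_PIdl:
  assumes fin: "finite (carrier R)" and frob: "frobenius_ring R" and C: "linear_code R n C"
    and b: "\<And>l. l \<in> {1..n} \<Longrightarrow> b l \<in> carrier R"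
  shows "card C * card {v \<in> dual_code R n C. \<forall>l\<in>{1..n}. v l \<in> PIdl (b l)} =
    (\<Prod>l\<in>{1..n}. card (PIdl (b l))) * card {c \<in> C. \<forall>l\<in>{1..n}. b l \<otimes> c l = \<zero>}"
proof -
  interpret symmetric_form R "free_module R n" "dot R n" by (rule symmetric_form_dot)
  let ?D = "PiE {1..n} (\<lambda>l. PIdl (b l))"
  have orth: "orthogonal B = dual_code R n B" for B by (simp add: orthogonal_def dual_code_def)
  have D: "submodule ?D R (free_module R n)" by (rule submodule_PiE_ideals) (rule cgenideal_ideal[OF b])
  have C': "submodule C R (free_module R n)" using C by (simp add: linear_code_def)
  have finM: "finite (carrier (free_module R n))" using fin by (auto simp: free_module_def intro: finite_PiE)
  have ext: "v \<in> PiE {1..n} (\<lambda>_. carrier R)" if "v \<in> C" for v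
    using submoduleE(1)[OF C'] that by (auto simp: free_module_def)
  have dual_D: "dual_code R n ?D = PiE {1..n} (\<lambda>l. principal_dual R (b l))"
    by (rule dual_code_PiE_PIdl) (rule b)
  have "?D \<inter> dual_code R n C = {v \<in> dual_code R n C. \<forall>l\<in>{1..n}. v l \<in> PIdl (b l)}"
    by (auto simp: dual_code_def free_module_def PiE_iff extensional_def)
  moreover have "C \<inter> dual_code R n ?D = {c \<in> C. \<forall>l\<in>{1..n}. b l \<otimes> c l = \<zero>}"
  proof -
    have "c \<in> PiE {1..n} (\<lambda>l. principal_dual R (b l)) \<longleftrightarrow> (\<forall>l\<in>{1..n}. b l \<otimes> c l = \<zero>)" if "c \<in> C" for c
      using ext[OF that] by (simp add: PiE_iff principal_dual_def)
    then show ?thesis unfolding dual_D by blast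
  qed
  moreover have "card ?D = (\<Prod>l\<in>{1..n}. card (PIdl (b l)))" by (simp add: card_PiE)
  ultimately show ?thesis
    using card_orthogonal[OF fin finM frob C' D] by (simp add: orth)
qed

section \<open>Polynomials\<close>

lemma comm_ring_hom_Const: "comm_ring_hom Const"
  by unfold_locales (simp_all add: Const_def single_add mult_single)

lemma Const_add: "Const (c + d) = Const c + Const d"
  by (simp add: Const_def single_add)

lemma Const_mult: "Const (c * d) = Const c * Const d"
  by (simp add: Const_def mult_single)

lemma Const_sum: "Const (sum f A) = (\<Sum>x\<in>A. Const (f x))"
  by (induction A rule: infinite_finite_induct) (simp_all add: Const_def single_add)

lemma Const_prod: "Const (prod f A) = (\<Prod>x\<in>A. Const (f x))"
  by (induction A rule: infinite_finite_induct) (simp_all add: Const_mult, simp_all add: Const_def)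

section \<open>Substitution into polynomials\<close>

text \<open>Exponent vectors outside the support have coefficient 0. This lets two polynomials and
  their sum be expanded over one common index set.\<close>

lemma mpoly_subst_superset:
  assumes "finite S" "Poly_Mapping.keys p \<subseteq> S"
  shows "mpoly_subst s p = (\<Sum>m\<in>S. Const (Poly_Mapping.lookup p m) *
    (\<Prod>i\<in>Poly_Mapping.keys m. s i ^ Poly_Mapping.lookup m i))"
  unfolding mpoly_subst_def using assms
  by (intro sum.mono_neutral_left) (auto simp: in_keys_iff Const_def)

lemma mpoly_subst_add: "mpoly_subst s (p + q) = mpoly_subst s p + mpoly_subst s q"
proof -
  let ?S = "Poly_Mapping.keys p \<union> Poly_Mapping.keys q"
  have "Poly_Mapping.keys (p + q) \<subseteq> ?S" by (rule keys_add)
  then show ?thesis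
    by (simp add: mpoly_subst_superset[of ?S] lookup_add Const_add distrib_right sum.distrib)
qed

lemma mpoly_subst_sum: "mpoly_subst s (sum f A) = (\<Sum>x\<in>A. mpoly_subst s (f x))"
  by (induction A rule: infinite_finite_induct) (simp_all add: mpoly_subst_add, simp_all add: mpoly_subst_def)

lemma Var_power: "Var i ^ k = Poly_Mapping.single (Poly_Mapping.single i k) 1"
  by (induction k) (simp_all add: Var_def mult_single flip: single_add)

lemma prod_Var_power:
  "finite A \<Longrightarrow> (\<Prod>i\<in>A. Var i ^ e i) = Poly_Mapping.single (\<Sum>i\<in>A. Poly_Mapping.single i (e i)) 1"
proof (induction A rule: finite_induct)
  case (insert i A)
  then show ?case by (simp add: Var_power mult_single)
qed simp

text \<open>Together with additivity this evaluates every substitution into \<open>swe\<close>,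
  which is a sum of such monomials.\<close>

lemma mpoly_subst_prod_Var_power:
  assumes "finite A"
  shows "mpoly_subst s (\<Prod>i\<in>A. Var i ^ e i) = (\<Prod>i\<in>A. s i ^ e i)"
proof -
  define m where "m = (\<Sum>i\<in>A. Poly_Mapping.single i (e i))"
  have lookup: "Poly_Mapping.lookup m j = (if j \<in> A then e j else 0)" for j
    using assms by (simp add: m_def lookup_sum lookup_single when_def sum.delta)
  have "mpoly_subst s (\<Prod>i\<in>A. Var i ^ e i) = (\<Prod>i\<in>Poly_Mapping.keys m. s i ^ Poly_Mapping.lookup m i)"
    by (simp add: prod_Var_power[OF assms] mpoly_subst_def Const_def flip: m_def)
  also have "\<dots> = (\<Prod>i\<in>A. s i ^ Poly_Mapping.lookup m i)"
  \<comment> \<open>An index of \<open>A\<close> with exponent 0 is not a key of \<open>m\<close>;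
    its factor is a zeroth power, hence 1.\<close>
  proof (rule prod.mono_neutral_left[OF assms])
    show "Poly_Mapping.keys m \<subseteq> A"
      by (rule subsetI) (simp add: in_keys_iff lookup split: if_splits)
    show "\<forall>i\<in>A - Poly_Mapping.keys m. s i ^ Poly_Mapping.lookup m i = 1"
      by (simp add: in_keys_iff)
  qed
  also have "\<dots> = (\<Prod>i\<in>A. s i ^ e i)" by (simp add: lookup)
  finally show ?thesis .
qed

lemma mpoly_subst_swe:
  "mpoly_subst s (swe R n t a C) = (\<Sum>c\<in>C. \<Prod>i\<le>t. s i ^ card (positions R n a i c))"
  by (simp add: swe_def mpoly_subst_sum mpoly_subst_prod_Var_power)

section \<open>Expanding products of linear forms\<close>

text \<open>Distributivity: \<open>J\<close> records which summand is chosen at each position.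
  Different \<open>J\<close> may yield the same monomial in \<open>y\<close>; such terms are kept
  apart, and the two expansions will be compared for each \<open>J\<close> separately.\<close>

lemma sum_prod_linear_forms:
  fixes g :: "'b \<Rightarrow> nat \<Rightarrow> 'k::comm_ring_1"
  assumes "finite I" "finite T"
  shows "(\<Sum>c\<in>C. \<Prod>l\<in>I. \<Sum>j\<in>T. Const (g (c l) j) * y j) =
    (\<Sum>J\<in>I \<rightarrow>\<^sub>E T. Const (\<Sum>c\<in>C. \<Prod>l\<in>I. g (c l) (J l)) * (\<Prod>l\<in>I. y (J l)))"
proof -
  have "(\<Sum>c\<in>C. \<Prod>l\<in>I. \<Sum>j\<in>T. Const (g (c l) j) * y j) =
      (\<Sum>c\<in>C. \<Sum>J\<in>I \<rightarrow>\<^sub>E T. \<Prod>l\<in>I. Const (g (c l) (J l)) * y (J l))"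
    using assms by (intro sum.cong refl prod_sum_PiE) auto
  also have "\<dots> = (\<Sum>J\<in>I \<rightarrow>\<^sub>E T. \<Sum>c\<in>C. \<Prod>l\<in>I. Const (g (c l) (J l)) * y (J l))"
    by (rule sum.swap)
  also have "\<dots> = (\<Sum>J\<in>I \<rightarrow>\<^sub>E T. Const (\<Sum>c\<in>C. \<Prod>l\<in>I. g (c l) (J l)) * (\<Prod>l\<in>I. y (J l)))"
    by (simp add: Const_sum Const_prod prod.distrib sum_distrib_right)
  finally show ?thesis .
qed

text \<open>A product of indicators is the indicator of the conjunction. Weights 1 serve the matrix
  A, weights |a_j R| the matrix QD.\<close>

lemma sum_prod_indicator:
  assumes "finite C" "finite I"
  shows "(\<Sum>c\<in>C. \<Prod>l\<in>I. if P l c then w l else 0 :: 'k::comm_ring_1) =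
    (\<Prod>l\<in>I. w l) * of_nat (card {c \<in> C. \<forall>l\<in>I. P l c})"
proof -
  have "(\<Prod>l\<in>I. if P l c then w l else 0) = (if \<forall>l\<in>I. P l c then \<Prod>l\<in>I. w l else 0)" for c
    using assms(2) by (auto intro!: prod.cong prod_zero)
  then show ?thesis using assms(1) by (simp add: sum.If_cases Int_def mult.commute)
qed

section \<open>The MacWilliams identity\<close>

locale finite_ring_representatives = cring R for R (structure) +
  fixes t :: nat and a :: "nat \<Rightarrow> 'a"
  assumes fin: "finite (carrier R)" and reps: "representatives R t a"
begin

lemma rep_carrier: "i \<le> t \<Longrightarrow> a i \<in> carrier R"
  using reps by (simp add: representatives_def)

lemma ex1_rep: "r \<in> carrier R \<Longrightarrow> \<exists>!i. i \<le> t \<and> PIdl r = PIdl (a i)"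
  using reps unfolding representatives_def
  by (metis (no_types, lifting) unit_equiv_iff_PIdl_eq[OF fin])

definition rep_index :: "'a \<Rightarrow> nat" where
  "rep_index r = (THE i. i \<le> t \<and> PIdl r = PIdl (a i))"

lemma rep_index:
  assumes "r \<in> carrier R" shows "rep_index r \<le> t" "PIdl (a (rep_index r)) = PIdl r"
  using theI'[OF ex1_rep[OF assms]] by (simp_all add: rep_index_def)

lemma rep_index_eq_iff:
  assumes "r \<in> carrier R" "i \<le> t" shows "rep_index r = i \<longleftrightarrow> PIdl r = PIdl (a i)"
  using rep_index[OF assms(1)] ex1_rep[OF assms(1)] assms(2) by metis

lemma inj_on_PIdl_rep: "inj_on (\<lambda>i. PIdl (a i)) {..t}"
  using rep_index_eq_iff[OF rep_carrier] by (intro inj_onI) (metis atMost_iff)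

text \<open>Grouping positions by class turns powers into a product over positions, the form to
  which distributivity applies.\<close>

lemma prod_positions:
  assumes "c \<in> carrier (free_module R n)"
  shows "(\<Prod>i\<le>t. s i ^ card (positions R n a i c)) = (\<Prod>l\<in>{1..n}. s (rep_index (c l)))"
proof -
  have c: "c l \<in> carrier R" if "l \<in> {1..n}" for l using assms that by (auto simp: free_module_def)
  have "(\<Prod>i\<le>t. s i ^ card (positions R n a i c)) =
      (\<Prod>i\<in>{..t}. \<Prod>l\<in>{l \<in> {1..n}. rep_index (c l) = i}. s (rep_index (c l)))"
  proof (rule prod.cong[OF refl])
    fix i assume "i \<in> {..t}"
    then have "positions R n a i c = {l \<in> {1..n}. rep_index (c l) = i}"
      using rep_index_eq_iff[OF c] by (auto simp: positions_def)
    then show "s i ^ card (positions R n a i c) =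
        (\<Prod>l\<in>{l \<in> {1..n}. rep_index (c l) = i}. s (rep_index (c l)))" by simp
  qed
  also have "\<dots> = (\<Prod>l\<in>{1..n}. s (rep_index (c l)))"
    by (rule prod.group) (use rep_index(1)[OF c] in auto)
  finally show ?thesis .
qed

text \<open>The theory \<open>Determinant\<close> has an \<open>adj_mat\<close> of its own, the adjugate; as \<open>Defs\<close> is imported after it,
  the unqualified name means the adjacency matrix.\<close>

lemma invertible_adj_mat: "invertible_mat (adj_mat R t a :: 'k::field mat)"
proof -
  let ?A = "adj_mat R t a :: 'k mat"
  have A: "?A \<in> carrier_mat (t + 1) (t + 1)" by (simp add: adj_mat_def)
  have "v = 0\<^sub>v (t + 1)" if v: "v \<in> carrier_vec (t + 1)" and Av: "?A *\<^sub>v v = 0\<^sub>v (t + 1)" for v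
  proof (rule ccontr)
    assume "v \<noteq> 0\<^sub>v (t + 1)"
    \<comment> \<open>Among the indices with a nonzero entry of \<open>v\<close>, take
      \<open>i\<close> whose ideal is maximal under inclusion. Row \<open>i\<close> of the system
      then has \<open>v $ i\<close> as its only nonzero term, a contradiction.\<close>
    define S where "S = {i. i \<le> t \<and> v $ i \<noteq> 0}"
    have "S \<noteq> {}" using \<open>v \<noteq> 0\<^sub>v (t + 1)\<close> v by (auto simp: S_def vec_eq_iff less_Suc_eq_le)
    moreover have "finite ((\<lambda>i. PIdl (a i)) ` S)" by (auto simp: S_def)
    ultimately obtain P where "P \<in> (\<lambda>i. PIdl (a i)) ` S"
      and P: "\<forall>Q\<in>(\<lambda>i. PIdl (a i)) ` S. P \<subseteq> Q \<longrightarrow> P = Q"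
      using finite_has_maximal[of "(\<lambda>i. PIdl (a i)) ` S"] by auto
    then obtain i where i: "i \<in> S" "P = PIdl (a i)" by blast
    have max: "PIdl (a j) = PIdl (a i)" if "j \<in> S" "PIdl (a i) \<subseteq> PIdl (a j)" for j
      using P that unfolding i(2) by auto
    have it: "i \<le> t" using i by (simp add: S_def)
    have only_i: "?A $$ (i, j) * v $ j = (if j = i then v $ j else 0)" if "j < t + 1" for j
      using max[of j] inj_onD[OF inj_on_PIdl_rep, of j i] it that
      by (auto simp: adj_mat_def S_def)
    have "0 = (?A *\<^sub>v v) $ i" using it Av by simp
    also have "\<dots> = (\<Sum>j\<in>{0..<t + 1}. ?A $$ (i, j) * v $ j)"
      using it v A by (simp add: mult_mat_vec_def scalar_prod_def)
    also have "\<dots> = (\<Sum>j\<in>{0..<t + 1}. if j = i then v $ j else 0)"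
      by (rule sum.cong[OF refl]) (use only_i in auto)
    also have "\<dots> = v $ i" using it by simp
    finally show False using i by (simp add: S_def)
  qed
  then have "det ?A \<noteq> 0" using det_0_iff_vec_prod_zero[OF A] by blast
  then have "?A \<in> Units (ring_mat TYPE('k) (t + 1) ())" by (rule det_non_zero_imp_unit[OF A])
  then obtain B where "B \<in> carrier_mat (t + 1) (t + 1)" "?A * B = 1\<^sub>m (t + 1)" "B * ?A = 1\<^sub>m (t + 1)"
    by (auto simp: Units_def ring_mat_def)
  then show ?thesis using A unfolding invertible_mat_def inverts_mat_def by auto
qed

section \<open>Matrix entries in terms of ring elements\<close>

text \<open>The quantifier over \<open>k\<close> reduces to \<open>k = j\<close>: if
  \<open>a i\<close> kills \<open>a j\<close>, it kills every element of the ideal of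
  \<open>a j\<close>. In this form the symmetry of Q is commutativity of the ring.\<close>

lemma q_mat_index:
  assumes "i \<le> t" "j \<le> t"
  shows "(q_mat R t a :: 'k::comm_ring_1 mat) $$ (i, j) = (if a i \<otimes> a j = \<zero> then 1 else 0)"
proof -
  note carr = rep_carrier[OF assms(1)] rep_carrier[OF assms(2)]
  have "(a i \<noteq> \<zero> \<and> (\<exists>k\<le>t. PIdl (a k) \<subseteq> PIdl (a j) \<and> a i \<otimes> a k \<noteq> \<zero>)) \<longleftrightarrow> a i \<otimes> a j \<noteq> \<zero>"
  proof (intro iffI conjI notI; (elim conjE exE)?)
    fix k assume k: "k \<le> t" "PIdl (a k) \<subseteq> PIdl (a j)" "a i \<otimes> a k \<noteq> \<zero>" and "a i \<otimes> a j = \<zero>"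
    then have "PIdl (a k) \<subseteq> principal_dual R (a i)"
      using PIdl_subset_principal_dual_iff carr by blast
    then show False using k PIdl_subset_principal_dual_iff carr rep_carrier by blast
  next
    assume "a i \<otimes> a j \<noteq> \<zero>" "a i = \<zero>"
    then show False using carr by simp
  qed (use assms in blast)
  then show ?thesis using assms by (simp add: q_mat_def)
qed

lemma q_mat_eq_q_mat': "(q_mat R t a :: 'k::comm_ring_1 mat) = q_mat' R t a"
proof (rule eq_matI)
  fix i j assume "i < dim_row (q_mat' R t a :: 'k mat)" "j < dim_col (q_mat' R t a :: 'k mat)"
  then have "i \<le> t" "j \<le> t" by (auto simp: q_mat'_def)
  then show "(q_mat R t a :: 'k mat) $$ (i, j) = q_mat' R t a $$ (i, j)"
    by (simp add: q_mat_index PIdl_subset_principal_dual_iff rep_carrier q_mat'_def)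
qed (simp_all add: q_mat_def q_mat'_def)

lemma transpose_q_mat: "transpose_mat (q_mat R t a :: 'k::comm_ring_1 mat) = q_mat R t a"
proof -
  have dim: "dim_row (q_mat R t a :: 'k mat) = t + 1" "dim_col (q_mat R t a :: 'k mat) = t + 1"
    by (simp_all add: q_mat_def)
  show ?thesis
    by (rule eq_matI) (auto simp: dim q_mat_index m_comm rep_carrier less_Suc_eq_le)
qed

text \<open>The entry of \<open>A y\<close> at the class of \<open>r\<close> is thus the sum of
  those \<open>y $ j\<close> whose ideal contains \<open>r\<close>.\<close>

lemma adj_mat_rep_index:
  assumes "r \<in> carrier R" "j \<le> t"
  shows "(adj_mat R t a :: 'k::comm_ring_1 mat) $$ (rep_index r, j) = (if r \<in> PIdl (a j) then 1 else 0)"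
  using rep_index[OF assms(1)] PIdl_subset_iff[OF assms(1) rep_carrier[OF assms(2)]] assms(2)
  by (simp add: adj_mat_def)

text \<open>Whether \<open>a j\<close> kills \<open>r\<close> depends only on the ideal of
  \<open>r\<close>, since it says that this ideal lies in the annihilator of \<open>a j\<close>; so
  \<open>r\<close> may replace its representative.\<close>

lemma q_size_mat_rep_index:
  assumes r: "r \<in> carrier R" and j: "j \<le> t"
  shows "(q_mat R t a * size_mat R t a :: 'k::comm_ring_1 mat) $$ (rep_index r, j) =
    (if a j \<otimes> r = \<zero> then of_nat (card (PIdl (a j))) else 0)"
proof -
  note i = rep_index[OF r]
  have "a (rep_index r) \<otimes> a j = \<zero> \<longleftrightarrow> a j \<otimes> r = \<zero>"
    using PIdl_subset_principal_dual_iff[OF r rep_carrier[OF j]] i(2)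
      PIdl_subset_principal_dual_iff[OF rep_carrier[OF i(1)] rep_carrier[OF j]]
      m_comm[OF rep_carrier[OF i(1)] rep_carrier[OF j]] by simp
  moreover have "q_mat R t a * size_mat R t a = mat (t + 1) (t + 1)
      (\<lambda>(i, j). q_mat R t a $$ (i, j) * (of_nat (card (PIdl (a j))) :: 'k))"
    unfolding size_mat_def by (rule mat_diag_mult_right) (simp add: q_mat_def)
  ultimately show ?thesis using i(1) j q_mat_index[OF i(1) j, where 'k = 'k] by simp
qed

theorem swe_dual_code:
  assumes frob: "frobenius_ring R" and C: "linear_code R n C"
  shows "swe R n t a (dual_code R n C) =
    Const (1 / of_nat (card C) :: 'k::field_char_0) *
    mat_subst t (q_mat R t a * size_mat R t a * inv_mat (adj_mat R t a)) (swe R n t a C)"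
proof -
  let ?A = "adj_mat R t a :: 'k mat" and ?x = "indeterminates t :: 'k mpoly vec"
  let ?B = "q_mat R t a * size_mat R t a :: 'k mat"
  let ?m = "t + 1"
  interpret Const: comm_ring_hom "Const :: 'k \<Rightarrow> 'k mpoly" by (rule comm_ring_hom_Const)
  have A: "?A \<in> carrier_mat ?m ?m" by (simp add: adj_mat_def)
  note inv = inv_mat_inverse[OF invertible_adj_mat A]
  have B: "?B \<in> carrier_mat ?m ?m"
    by (rule mult_carrier_mat[of _ _ ?m]) (simp_all add: q_mat_def size_mat_def mat_diag_def)
  have x: "?x \<in> carrier_vec ?m" by (simp add: indeterminates_def)
  define y where "y = map_mat Const (inv_mat ?A) *\<^sub>v ?x"
  have y: "y \<in> carrier_vec ?m" unfolding y_def using inv(1) x by auto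
  \<comment> \<open>For \<open>M = A\<close> this gives \<open>x = A y\<close>; for
    \<open>M = QD\<close> it rewrites the vector substituted on the right-hand side in terms of
    \<open>y\<close>.\<close>
  have mult_y: "map_mat Const (M * inv_mat ?A) *\<^sub>v ?x = map_mat Const M *\<^sub>v y"
    if "M \<in> carrier_mat ?m ?m" for M
    unfolding y_def Const.mat_hom_mult[OF that inv(1)]
    by (rule assoc_mult_mat_vec) (use that inv(1) x in auto)
  have entry: "(map_mat Const M *\<^sub>v y) $ i = (\<Sum>j\<in>{..t}. Const (M $$ (i, j)) * y $ j)"
    if "M \<in> carrier_mat ?m ?m" "i \<le> t" for M i
  proof -
    have "{0..<?m} = {..t}" by auto
    then show ?thesis using that y by (simp add: scalar_prod_def del: sum.op_ivl_Suc)
  qed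
  have Var: "Var i = (\<Sum>j\<in>{..t}. Const (?A $$ (i, j)) * y $ j)" if "i \<le> t" for i
  proof -
    have "?x = map_mat Const ?A *\<^sub>v y"
      using mult_y[OF A] x by (simp add: inv Const.mat_hom_one del: One_nat_def add_Suc_right)
    then have "?x $ i = (\<Sum>j\<in>{..t}. Const (?A $$ (i, j)) * y $ j)" using entry[OF A that] by simp
    then show ?thesis using that by (simp add: indeterminates_def)
  qed
  have C_sub: "submodule C R (free_module R n)" using C by (simp add: linear_code_def)
  interpret M: module R "free_module R n" by (rule free_module_is_module[OF is_cring])
  have finM: "finite (carrier (free_module R n))"
    using fin by (auto simp: free_module_def intro: finite_PiE)
  have C_carr: "C \<subseteq> carrier (free_module R n)" using M.submoduleE(1)[OF C_sub] .
  have dual_carr: "dual_code R n C \<subseteq> carrier (free_module R n)" by (auto simp: dual_code_def)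
  have carr: "c l \<in> carrier R" if "c \<in> carrier (free_module R n)" "l \<in> {1..n}" for c l
    using that by (auto simp: free_module_def)
  have finC: "finite C" "finite (dual_code R n C)"
    using C_carr dual_carr finM by (auto intro: finite_subset)
  \<comment> \<open>A submodule is nonempty, so division by \<open>card C\<close> is legitimate in
    characteristic 0.\<close>
  have "card C \<noteq> 0" using M.submoduleE(2)[OF C_sub] finC by simp
  let ?T = "{1..n} \<rightarrow>\<^sub>E {..t}"
  \<comment> \<open>In the expansions over \<open>J\<close>, the product of the
    \<open>y $ J l\<close> has coefficient \<open>N J\<close> for the dual code and
    \<open>w J * N' J\<close> for the substituted enumerator of \<open>C\<close>.\<close>
  define N where "N J = card {v \<in> dual_code R n C. \<forall>l\<in>{1..n}. v l \<in> PIdl (a (J l))}" for J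
  define N' where "N' J = card {c \<in> C. \<forall>l\<in>{1..n}. a (J l) \<otimes> c l = \<zero>}" for J
  define w where "w J = (\<Prod>l\<in>{1..n}. card (PIdl (a (J l))))" for J
  have "swe R n t a (dual_code R n C) =
      (\<Sum>v\<in>dual_code R n C. \<Prod>l\<in>{1..n}. Var (rep_index (v l)) :: 'k mpoly)"
    unfolding swe_def using dual_carr by (intro sum.cong refl prod_positions) auto
  also have "\<dots> = (\<Sum>v\<in>dual_code R n C. \<Prod>l\<in>{1..n}. \<Sum>j\<in>{..t}. Const (?A $$ (rep_index (v l), j)) * y $ j)"
    using dual_carr by (intro sum.cong prod.cong refl Var rep_index(1) carr) auto
  also have "\<dots> = (\<Sum>J\<in>?T. Const (\<Sum>v\<in>dual_code R n C. \<Prod>l\<in>{1..n}. ?A $$ (rep_index (v l), J l)) *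
      (\<Prod>l\<in>{1..n}. y $ J l))"
    by (rule sum_prod_linear_forms) simp_all
  also have "\<dots> = (\<Sum>J\<in>?T. Const (of_nat (N J)) * (\<Prod>l\<in>{1..n}. y $ J l))"
  proof (rule sum.cong[OF refl])
    fix J assume J: "J \<in> ?T"
    have "(\<Sum>v\<in>dual_code R n C. \<Prod>l\<in>{1..n}. ?A $$ (rep_index (v l), J l)) =
        (\<Sum>v\<in>dual_code R n C. \<Prod>l\<in>{1..n}. if v l \<in> PIdl (a (J l)) then 1 else 0)"
      using dual_carr J by (intro sum.cong prod.cong refl adj_mat_rep_index carr) auto
    then show "Const (\<Sum>v\<in>dual_code R n C. \<Prod>l\<in>{1..n}. ?A $$ (rep_index (v l), J l)) *
        (\<Prod>l\<in>{1..n}. y $ J l) = Const (of_nat (N J)) * (\<Prod>l\<in>{1..n}. y $ J l)"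
      using finC by (simp add: sum_prod_indicator N_def)
  qed
  finally have lhs: "swe R n t a (dual_code R n C) =
      (\<Sum>J\<in>?T. Const (of_nat (N J)) * (\<Prod>l\<in>{1..n}. y $ J l))" .
  have "mat_subst t (?B * inv_mat ?A) (swe R n t a C) =
      (\<Sum>c\<in>C. \<Prod>l\<in>{1..n}. (map_mat Const ?B *\<^sub>v y) $ rep_index (c l))"
    unfolding mat_subst_def mpoly_subst_swe mult_y[OF B]
    using C_carr by (intro sum.cong refl prod_positions) auto
  also have "\<dots> = (\<Sum>c\<in>C. \<Prod>l\<in>{1..n}. \<Sum>j\<in>{..t}. Const (?B $$ (rep_index (c l), j)) * y $ j)"
    using C_carr by (intro sum.cong prod.cong refl entry[OF B] rep_index(1) carr) auto
  also have "\<dots> = (\<Sum>J\<in>?T. Const (\<Sum>c\<in>C. \<Prod>l\<in>{1..n}. ?B $$ (rep_index (c l), J l)) *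
      (\<Prod>l\<in>{1..n}. y $ J l))"
    by (rule sum_prod_linear_forms) simp_all
  also have "\<dots> = (\<Sum>J\<in>?T. Const (of_nat (card C) * of_nat (N J)) * (\<Prod>l\<in>{1..n}. y $ J l))"
  proof (rule sum.cong[OF refl])
    fix J assume J: "J \<in> ?T"
    have "(\<Sum>c\<in>C. \<Prod>l\<in>{1..n}. ?B $$ (rep_index (c l), J l)) =
        (\<Sum>c\<in>C. \<Prod>l\<in>{1..n}. if a (J l) \<otimes> c l = \<zero> then of_nat (card (PIdl (a (J l)))) else 0)"
      using C_carr J by (intro sum.cong prod.cong refl q_size_mat_rep_index carr) auto
    also have "\<dots> = of_nat (w J * N' J)"
      using finC by (simp add: sum_prod_indicator w_def N'_def)
    \<comment> \<open>The Frobenius property enters here, through the counting identity for the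
      product of the ideals generated by the \<open>a (J l)\<close>.\<close>
    also have "w J * N' J = card C * N J"
      unfolding w_def N'_def N_def using rep_carrier PiE_mem[OF J]
      by (intro card_dual_code_PIdl[OF fin frob C, symmetric]) simp
    finally show "Const (\<Sum>c\<in>C. \<Prod>l\<in>{1..n}. ?B $$ (rep_index (c l), J l)) *
        (\<Prod>l\<in>{1..n}. y $ J l) = Const (of_nat (card C) * of_nat (N J)) * (\<Prod>l\<in>{1..n}. y $ J l)"
      by simp
  qed
  finally have rhs: "mat_subst t (?B * inv_mat ?A) (swe R n t a C) =
      (\<Sum>J\<in>?T. Const (of_nat (card C) * of_nat (N J)) * (\<Prod>l\<in>{1..n}. y $ J l))" .
  have "Const (1 / of_nat (card C)) * Const (of_nat (card C) * of_nat (N J)) =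
      (Const (of_nat (N J)) :: 'k mpoly)" for J
    using \<open>card C \<noteq> 0\<close> by (simp flip: Const_mult)
  then show ?thesis
    unfolding lhs rhs by (simp add: sum_distrib_left mult.assoc[symmetric])
qed

end

theorem theorem10:
  fixes R :: "('a, 'r) ring_scheme"
    and n t :: nat
    and a :: "nat \<Rightarrow> 'a"
    and C :: "(nat \<Rightarrow> 'a) set"
  assumes "cring R"
    and "finite (carrier R)"
    and "frobenius_ring R"
    and "representatives R t a"
    and "linear_code R n C"
  shows "invertible_mat (adj_mat R t a :: 'k::field_char_0 mat)
    \<and> transpose_mat (q_mat R t a :: 'k mat) = q_mat R t a
    \<and> (q_mat R t a :: 'k mat) = q_mat' R t a
    \<and> swe R n t a (dual_code R n C) =
        Const (1 / of_nat (card C) :: 'k) *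
        mat_subst t (q_mat R t a * size_mat R t a * inv_mat (adj_mat R t a)) (swe R n t a C)"
proof -
  interpret finite_ring_representatives R t a
    using assms by (simp add: finite_ring_representatives_def finite_ring_representatives_axioms_def)
  show ?thesis
    using invertible_adj_mat transpose_q_mat q_mat_eq_q_mat' swe_dual_code[OF assms(3,5)] by blast
qed

end
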